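(* Let $p$ be a prime, $K=\mathbb{Q}_p$, and let $F(X,Y)=X+Y+XY$ be the multiplicative formal group law over $\mathbb{Z}_p$. Let $\eta$ be a primitive $p$-th root of unity, let $\Pi=\zeta=\eta-1$ (a nonzero root of the isogeny $[p](X)=(1+X)^p-1$), and let $L=K(\zeta)$. Let $x\in F(\mathfrak{m}_L)$, and let $y$ be such that $[p](y)=x$ and $y\in F(\mathfrak{m}_M)$ for some unramified $p$-extension $M/L$ (i.e. an unramified extension whose degree is a power of $p$) such that $M$ contains no primitive $p^2$-th root of unity. Let $\gamma\in\mathbb{Z}_p$ be such that $(\Pi,x)_1=[\gamma](\zeta)$; such a $\gamma$ is determined modulo $p$. Then $$\gamma\equiv\frac{1}{p}\operatorname{Tr}_{L/K}\left(\Pi^{-1}\,\eta\,\lambda(x)\right) \pmod p .$$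
   Context: For a finite extension $E/\mathbb{Q}_p$, $\mathfrak{m}_E$ is the maximal ideal of its ring of integers. $F(\mathfrak{m}_E)$ denotes $\mathfrak{m}_E$ with the group operation $a+_F b=F(a,b)$ (and corresponding subtraction $-_F$) and the $\mathbb{Z}_p$-module structure $\alpha\cdot a=[\alpha](a)$, where for the multiplicative formal group law $[\alpha](X)=(1+X)^\alpha-1$. The formal logarithm is $\lambda(X)=\log(1+X)$. The kernel of $[p]$ is $\{\eta^i-1: 0\le i<p\}$, and it is generated by $\zeta=\eta-1$. The generalised Hilbert pairing is defined as follows: for $t\in L^\times$ and $x\in F(\mathfrak{m}_L)$ such that $x=[p](y)$ with $y\in F(\mathfrak{m}_M)$, $M/L$ unramified, $$(t,x)_1=\sigma_t(y)-_F y\in\ker[p],$$ where $\sigma_{(\cdot)}:L^\times\to\operatorname{Gal}(L^{ab}/L)$ is the local reciprocity map, normalized so that a prime element of $L$ acts on unramified extensions of $L$ as the (arithmetic) Frobenius automorphism. The element $\Pi$ is a prime element of $L$. The value of $(t,x)_1$ does not depend on the choice of $y$. *)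

theory Defs
  imports
    "HOL-Analysis.Elementary_Metric_Spaces"
    "HOL-Computational_Algebra.Formal_Power_Series"
    "HOL-Algebra.Algebraic_Closure_Type"
    "HOL-Algebra.Generated_Fields"
    "Jordan_Normal_Form.Determinant"
begin

text \<open>
  The ground field, its algebraic closure and all intermediate fields are subsets of one type, whose
  metric is the one given by the absolute value. The \<open>HOL-Algebra\<close> notions of subfields, bases
  and dimension are applied to \<open>ring_of_type_algebra\<close>, the ring record with carrier
  \<open>UNIV\<close>; limits and infinite sums are those of \<open>metric_space\<close>.
\<close>

abbreviation ambient :: "'a::field_char_0 ring" where
  "ambient \<equiv> ring_of_type_algebra"

definition pabs :: "'a::{field_char_0, metric_space} \<Rightarrow> real" where
  "pabs a = dist a 0"

text \<open>
  \<open>K\<close> is the field of \<open>p\<close>-adic numbers, i.e.\ the completion of the rationals for the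
  \<open>p\<close>-adic absolute value, and the whole type is an algebraic closure of \<open>K\<close>, with
  the (unique) extension of the absolute value. By multiplicativity, its values on
  the integers fix it on all rationals.
\<close>

definition padic_closure :: "nat \<Rightarrow> 'a::{field_char_0, metric_space} set \<Rightarrow> bool" where
  "padic_closure p K \<longleftrightarrow> prime p \<and>
     (\<forall>a b :: 'a. dist a b = pabs (a - b)) \<and>
     (\<forall>a b :: 'a. pabs (a * b) = pabs a * pabs b) \<and>
     (\<forall>a b :: 'a. pabs (a + b) \<le> max (pabs a) (pabs b)) \<and>
     (\<forall>m. m \<noteq> 0 \<longrightarrow> pabs (of_int m :: 'a) = (1 / real p) ^ multiplicity (int p) m) \<and>
     \<rat> \<subseteq> K \<and> K \<subseteq> closure \<rat> \<and> complete K \<and>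
     algebraic_closure (ambient :: 'a ring) K"

definition int_ring :: "'a::{field_char_0, metric_space} set \<Rightarrow> 'a set" where
  "int_ring E = {a \<in> E. pabs a \<le> 1}"

definition max_ideal :: "'a::{field_char_0, metric_space} set \<Rightarrow> 'a set" where
  "max_ideal E = {a \<in> E. pabs a < 1}"

definition prime_element :: "'a::{field_char_0, metric_space} set \<Rightarrow> 'a \<Rightarrow> bool" where
  "prime_element E \<pi> \<longleftrightarrow> \<pi> \<noteq> 0 \<and> max_ideal E = (\<lambda>a. \<pi> * a) ` int_ring E"

definition residue_card :: "'a::{field_char_0, metric_space} set \<Rightarrow> nat" where
  "residue_card E =
     card (int_ring E // {(a, b). a \<in> int_ring E \<and> b \<in> int_ring E \<and> a - b \<in> max_ideal E})"

definition primitive_root_of_unity :: "nat \<Rightarrow> 'a::field_char_0 \<Rightarrow> bool" where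
  "primitive_root_of_unity n z \<longleftrightarrow> n > 0 \<and> z ^ n = 1 \<and> (\<forall>m. 0 < m \<and> m < n \<longrightarrow> z ^ m \<noteq> 1)"

subsection \<open>Finite extensions, norm and trace\<close>

definition finite_ext :: "'a::field_char_0 set \<Rightarrow> 'a set \<Rightarrow> bool" where
  "finite_ext L M \<longleftrightarrow> subfield L ambient \<and> subfield M ambient \<and> L \<subseteq> M \<and>
     ring.finite_dimension ambient L M"

definition is_basis :: "'a::field_char_0 set \<Rightarrow> 'a set \<Rightarrow> 'a list \<Rightarrow> bool" where
  "is_basis L M us \<longleftrightarrow> ring.independent ambient L us \<and> ring.Span ambient L us = M"

definition coords :: "'a::field_char_0 set \<Rightarrow> 'a list \<Rightarrow> 'a \<Rightarrow> 'a list" where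
  "coords L us a =
     (THE cs. set cs \<subseteq> L \<and> length cs = length us \<and> a = ring.combine ambient cs us)"

text \<open>The matrix of the \<open>L\<close>-linear map \<open>b \<mapsto> a * b\<close> with respect to the basis \<open>us\<close>.\<close>

definition mult_matrix :: "'a::field_char_0 set \<Rightarrow> 'a list \<Rightarrow> 'a \<Rightarrow> 'a mat" where
  "mult_matrix L us a =
     mat (length us) (length us) (\<lambda>(i, j). coords L us (a * us ! j) ! i)"

text \<open>Trace and determinant do not depend on the basis that is selected here.\<close>

definition field_trace :: "'a::field_char_0 set \<Rightarrow> 'a set \<Rightarrow> 'a \<Rightarrow> 'a" where
  "field_trace L M a =
     (let A = mult_matrix L (SOME us. is_basis L M us) a in \<Sum>i<dim_row A. A $$ (i, i))"

definition field_norm :: "'a::field_char_0 set \<Rightarrow> 'a set \<Rightarrow> 'a \<Rightarrow> 'a" where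
  "field_norm L M a = det (mult_matrix L (SOME us. is_basis L M us) a)"

subsection \<open>Galois theory and the local reciprocity map\<close>

text \<open>Automorphisms of \<open>M\<close> over \<open>L\<close>; the values outside \<open>M\<close> are irrelevant.\<close>

definition field_aut :: "'a::field_char_0 set \<Rightarrow> 'a set \<Rightarrow> ('a \<Rightarrow> 'a) \<Rightarrow> bool" where
  "field_aut L M \<tau> \<longleftrightarrow> bij_betw \<tau> M M \<and>
     (\<forall>a\<in>M. \<forall>b\<in>M. \<tau> (a + b) = \<tau> a + \<tau> b \<and> \<tau> (a * b) = \<tau> a * \<tau> b) \<and> (\<forall>a\<in>L. \<tau> a = a)"

definition finite_abelian_ext :: "'a::field_char_0 set \<Rightarrow> 'a set \<Rightarrow> bool" where
  "finite_abelian_ext L M \<longleftrightarrow> finite_ext L M \<and>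
     (\<forall>a\<in>M. (\<forall>\<tau>. field_aut L M \<tau> \<longrightarrow> \<tau> a = a) \<longrightarrow> a \<in> L) \<and>
     (\<forall>\<sigma> \<tau>. field_aut L M \<sigma> \<longrightarrow> field_aut L M \<tau> \<longrightarrow> (\<forall>a\<in>M. \<sigma> (\<tau> a) = \<tau> (\<sigma> a)))"

definition max_abelian_ext :: "'a::field_char_0 set \<Rightarrow> 'a set" where
  "max_abelian_ext L = \<Union>{M. finite_abelian_ext L M}"

text \<open>
  Ramification index 1. Separability of the residue extension is automatic, as the residue fields
  in question are finite.
\<close>

definition unramified_ext :: "'a::{field_char_0, metric_space} set \<Rightarrow> 'a set \<Rightarrow> bool" where
  "unramified_ext L M \<longleftrightarrow> finite_ext L M \<and> (\<exists>\<pi>. prime_element L \<pi> \<and> prime_element M \<pi>)"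

definition is_frobenius ::
    "'a::{field_char_0, metric_space} set \<Rightarrow> 'a set \<Rightarrow> ('a \<Rightarrow> 'a) \<Rightarrow> bool" where
  "is_frobenius L M \<tau> \<longleftrightarrow> field_aut L M \<tau> \<and>
     (\<forall>a\<in>int_ring M. \<tau> a - a ^ residue_card L \<in> max_ideal M)"

text \<open>
  The local reciprocity map is the only homomorphism from the multiplicative group of \<open>L\<close> to the
  Galois group of the maximal abelian extension such that prime elements act as arithmetic
  Frobenius on finite unramified extensions and such that, for every finite abelian extension
  \<open>M\<close>, it induces an isomorphism from the multiplicative group of \<open>L\<close> modulo norms from
  \<open>M\<close> to the Galois group of \<open>M\<close> over \<open>L\<close>.
\<close>

definition local_reciprocity_map ::
    "'a::{field_char_0, metric_space} set \<Rightarrow> ('a \<Rightarrow> 'a \<Rightarrow> 'a) \<Rightarrow> bool" where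
  "local_reciprocity_map L \<sigma> \<longleftrightarrow>
     (\<forall>t\<in>L - {0}. field_aut L (max_abelian_ext L) (\<sigma> t)) \<and>
     (\<forall>s\<in>L - {0}. \<forall>t\<in>L - {0}. \<forall>a\<in>max_abelian_ext L. \<sigma> (s * t) a = \<sigma> s (\<sigma> t a)) \<and>
     (\<forall>\<pi> M. prime_element L \<pi> \<longrightarrow> unramified_ext L M \<longrightarrow> is_frobenius L M (\<sigma> \<pi>)) \<and>
     (\<forall>M. finite_abelian_ext L M \<longrightarrow>
        {t \<in> L - {0}. \<forall>a\<in>M. \<sigma> t a = a} = field_norm L M ` (M - {0}) \<and>
        (\<forall>\<tau>. field_aut L M \<tau> \<longrightarrow> (\<exists>t\<in>L - {0}. \<forall>a\<in>M. \<sigma> t a = \<tau> a)))"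

subsection \<open>The multiplicative formal group\<close>

definition eval_series :: "'a::{field_char_0, metric_space} fps \<Rightarrow> 'a \<Rightarrow> 'a" where
  "eval_series f a = (\<Sum>n. fps_nth f n * a ^ n)"

definition mfg_add :: "'a::field_char_0 \<Rightarrow> 'a \<Rightarrow> 'a" where
  "mfg_add a b = a + b + a * b"

definition mfg_neg :: "'a::field_char_0 \<Rightarrow> 'a" where
  "mfg_neg b = - b / (1 + b)"

definition mfg_diff :: "'a::field_char_0 \<Rightarrow> 'a \<Rightarrow> 'a" where
  "mfg_diff a b = mfg_add a (mfg_neg b)"

lemma mfg_add_neg: "1 + b \<noteq> 0 \<Longrightarrow> mfg_add b (mfg_neg b) = 0"
  by (simp add: mfg_add_def mfg_neg_def divide_simps) (simp add: algebra_simps)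

text \<open>The binomial series \<open>(1 + X) ^ \<alpha> - 1\<close>.\<close>

definition mfg_mult :: "'a::{field_char_0, metric_space} \<Rightarrow> 'a \<Rightarrow> 'a" where
  "mfg_mult \<alpha> a = eval_series (fps_binomial \<alpha> - 1) a"

lemma mfg_mult_of_nat: "mfg_mult (of_nat n) a = (1 + a) ^ n - 1"
proof -
  have bin: "of_nat n gchoose k = (of_nat (n choose k) :: 'a)" for k
    by (simp add: binomial_gbinomial)
  have "mfg_mult (of_nat n) a =
      (\<Sum>k\<le>n. fps_nth (fps_binomial (of_nat n) - 1) k * a ^ k)"
    unfolding mfg_mult_def eval_series_def
    by (rule suminf_finite) (auto simp: bin binomial_eq_0)
  also have "\<dots> = (\<Sum>k\<le>n. of_nat (n choose k) * a ^ k) - (\<Sum>k\<le>n. fps_nth 1 k * a ^ k)"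
    by (simp add: bin left_diff_distrib sum_subtractf)
  also have "(\<Sum>k\<le>n. fps_nth 1 k * a ^ k) = 1"
    by (subst sum.remove[of _ 0]) (auto intro!: sum.neutral)
  also have "(\<Sum>k\<le>n. of_nat (n choose k) * a ^ k) = (1 + a) ^ n"
    using binomial_ring[of a 1 n] by (simp add: add.commute)
  finally show ?thesis .
qed

text \<open>The logarithm series \<open>log (1 + X)\<close>.\<close>

definition mfg_log :: "'a::{field_char_0, metric_space} \<Rightarrow> 'a" where
  "mfg_log a = eval_series (fps_ln 1) a"

text \<open>
  The pairing of \<open>t\<close> and \<open>x\<close> for the isogeny \<open>[p]\<close>, where \<open>\<sigma>\<close> is the local
  reciprocity map of \<open>L\<close>. It is meaningful when \<open>x = [p](y)\<close> for some \<open>y\<close> in the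
  maximal ideal of an unramified extension of \<open>L\<close>; its value does not depend on \<open>y\<close>.
\<close>

definition hilbert_pairing :: "nat \<Rightarrow> 'a::{field_char_0, metric_space} set \<Rightarrow>
    ('a \<Rightarrow> 'a \<Rightarrow> 'a) \<Rightarrow> 'a \<Rightarrow> 'a \<Rightarrow> 'a" where
  "hilbert_pairing p L \<sigma> t x =
     (THE z. \<exists>M y. unramified_ext L M \<and> y \<in> max_ideal M \<and> mfg_mult (of_nat p) y = x \<and>
        z = mfg_diff (\<sigma> t y) y)"

end

theory Submission
  imports Defs
begin

text \<open>
  Since \<open>\<zeta>\<close> is a prime element of \<open>L\<close> and \<open>M\<close> is unramified over \<open>L\<close>, one can write
  \<open>y = \<zeta> * s\<close> with \<open>s\<close> integral. As \<open>\<zeta> ^ (p - 1)\<close> is congruent to \<open>- p\<close>, expanding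
  \<open>x = (1 + \<zeta> * s) ^ p - 1\<close> gives \<open>x \<equiv> p * \<zeta> * (s - s ^ p)\<close> modulo \<open>p * \<zeta>\<close> times
  the maximal ideal. The element \<open>\<zeta>\<close> acts on \<open>M\<close> as Frobenius, that is, as \<open>s \<mapsto> s ^ p\<close> on residue
  classes. If it multiplies \<open>1 + y\<close> by \<open>\<eta> ^ c\<close>, it also acts on the class of \<open>s\<close> as
  \<open>s \<mapsto> s + c\<close>; hence \<open>x \<equiv> - c * p * \<zeta>\<close>. The logarithm does not change this leading term, so
  \<open>\<eta> * \<lambda>(x) / (p * \<zeta>) \<equiv> - c\<close>, and the trace from \<open>L\<close> to \<open>K\<close> of an integral element congruent to
  \<open>- c\<close> is congruent to \<open>- c * (p - 1)\<close>, i.e. to \<open>c\<close>.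
\<close>

section \<open>Ultrametric estimates\<close>

locale padic =
  fixes p :: nat and K :: "'a::{field_char_0, metric_space} set"
  assumes padic_closure: "padic_closure p K"
begin

lemma prime_p: "prime p"
  and dist_eq: "dist (a :: 'a) b = pabs (a - b)"
  and pabs_mult: "pabs (a * b :: 'a) = pabs a * pabs b"
  and ultrametric: "pabs (a + b :: 'a) \<le> max (pabs a) (pabs b)"
  and pabs_int: "m \<noteq> 0 \<Longrightarrow> pabs (of_int m :: 'a) = (1 / real p) ^ multiplicity (int p) m"
  and K_subset_closure_Rats: "K \<subseteq> closure \<rat>"
  and complete_K: "complete K"
  and algebraic_closure_K: "algebraic_closure (ambient :: 'a ring) K"
  using padic_closure unfolding padic_closure_def by auto

lemma p_gt_1: "p > 1"
  using prime_p prime_gt_1_nat by blast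

lemma pabs_nonneg [simp]: "pabs (a :: 'a) \<ge> 0"
  by (simp add: pabs_def)

lemma pabs_eq_0_iff [simp]: "pabs (a :: 'a) = 0 \<longleftrightarrow> a = 0"
  by (simp add: pabs_def)

lemma pabs_pos_iff [simp]: "pabs (a :: 'a) > 0 \<longleftrightarrow> a \<noteq> 0"
  by (simp add: pabs_def)

lemma pabs_0 [simp]: "pabs (0 :: 'a) = 0"
  by simp

lemma pabs_1 [simp]: "pabs (1 :: 'a) = 1"
  using pabs_int[of 1] by simp

lemma pabs_minus_commute: "pabs (a - b :: 'a) = pabs (b - a)"
  by (metis dist_eq dist_commute)

lemma pabs_minus [simp]: "pabs (- a :: 'a) = pabs a"
  using pabs_minus_commute[of 0 a] by simp

lemma ultrametric_diff: "pabs (a - b :: 'a) \<le> max (pabs a) (pabs b)"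
  using ultrametric[of a "- b"] by simp

lemma pabs_add_le: "pabs a \<le> B \<Longrightarrow> pabs b \<le> B \<Longrightarrow> pabs (a + b :: 'a) \<le> B"
  using ultrametric[of a b] by simp

lemma pabs_add_less: "pabs a < B \<Longrightarrow> pabs b < B \<Longrightarrow> pabs (a + b :: 'a) < B"
  using ultrametric[of a b] by simp

lemma pabs_diff_le: "pabs a \<le> B \<Longrightarrow> pabs b \<le> B \<Longrightarrow> pabs (a - b :: 'a) \<le> B"
  using ultrametric_diff[of a b] by simp

lemma pabs_diff_less: "pabs a < B \<Longrightarrow> pabs b < B \<Longrightarrow> pabs (a - b :: 'a) < B"
  using ultrametric_diff[of a b] by simp

text \<open>Since b = (a + b) - a and a is strictly smaller than b, the ultrametric bound on b can
  only be attained by a + b.\<close>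

lemma pabs_add_eq_right: "pabs a < pabs b \<Longrightarrow> pabs (a + b :: 'a) = pabs b"
  using ultrametric[of a b] ultrametric_diff[of "a + b" a] by (auto simp: max_def split: if_splits)

lemma one_plus_nonzero: "pabs b < 1 \<Longrightarrow> 1 + b \<noteq> (0 :: 'a)"
  using pabs_minus[of 1] by (auto simp: add_eq_0_iff)

lemma pabs_add_eq_max: "pabs a \<noteq> pabs b \<Longrightarrow> pabs (a + b :: 'a) = max (pabs a) (pabs b)"
  using pabs_add_eq_right[of a b] pabs_add_eq_right[of b a]
  by (cases "pabs a < pabs b") (auto simp: add.commute max_def)

lemma pabs_sum_le:
  assumes "\<And>i. i \<in> A \<Longrightarrow> pabs (f i :: 'a) \<le> B" and "B \<ge> 0"
  shows "pabs (sum f A) \<le> B"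
  using assms by (induction A rule: infinite_finite_induct) (auto intro!: pabs_add_le)

lemma pabs_sum_less:
  assumes "\<And>i. i \<in> A \<Longrightarrow> pabs (f i :: 'a) < B" and "B > 0"
  shows "pabs (sum f A) < B"
  using assms by (induction A rule: infinite_finite_induct) (auto intro!: pabs_add_less)

lemma pabs_power: "pabs (a ^ n :: 'a) = pabs a ^ n"
  by (induction n) (auto simp: pabs_mult)

lemma pabs_inverse: "pabs (inverse a :: 'a) = inverse (pabs a)"
proof (cases "a = 0")
  case False
  have "pabs a * pabs (inverse a) = 1"
    using False by (simp flip: pabs_mult)
  thus ?thesis by (simp add: inverse_unique)
qed simp

lemma pabs_divide: "pabs (a / b :: 'a) = pabs a / pabs b"
  by (simp add: divide_inverse pabs_mult pabs_inverse)

lemma pabs_prod: "pabs (prod f A :: 'a) = (\<Prod>i\<in>A. pabs (f i))"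
  by (induction A rule: infinite_finite_induct) (auto simp: pabs_mult)

lemma pabs_of_int_le_1: "pabs (of_int m :: 'a) \<le> 1"
  using pabs_int[of m] p_gt_1 by (cases "m = 0") (auto simp: power_le_one)

lemma pabs_of_nat_le_1: "pabs (of_nat m :: 'a) \<le> 1"
  using pabs_of_int_le_1[of "int m"] by simp

lemma pabs_of_int_less_1_iff: "pabs (of_int m :: 'a) < 1 \<longleftrightarrow> int p dvd m"
proof (cases "m = 0")
  case False
  have "(1 / real p) ^ k < 1 \<longleftrightarrow> k > 0" for k
    using p_gt_1 power_Suc_less_one[of "1 / real p" "k - 1"] by (cases k) auto
  hence "pabs (of_int m :: 'a) < 1 \<longleftrightarrow> multiplicity (int p) m > 0"
    using pabs_int[OF False] by simp
  also have "\<dots> \<longleftrightarrow> int p dvd m"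
    using prime_p False
    by (simp add: prime_multiplicity_gt_zero_iff)
  finally show ?thesis .
qed simp

lemma pabs_p: "pabs (of_nat p :: 'a) = 1 / real p"
  using pabs_int[of "int p"] prime_p p_gt_1 by simp

lemma pabs_of_nat_dvd_le: "p dvd m \<Longrightarrow> pabs (of_nat m :: 'a) \<le> 1 / real p"
  using pabs_of_nat_le_1 by (auto elim!: dvdE simp: pabs_mult pabs_p divide_simps)

text \<open>Nonzero terms of pairwise different size cannot cancel, so the sum is as large as its
  largest term. The second conjunct carries the induction: it names a term of the size of the
  partial sum, with which the new term can be compared.\<close>

lemma pabs_sum_dominant:
  assumes "finite A"
    and "\<And>i j. i \<in> A \<Longrightarrow> j \<in> A \<Longrightarrow> i \<noteq> j \<Longrightarrow> f i \<noteq> 0 \<Longrightarrow> f j \<noteq> 0 \<Longrightarrow> pabs (f i :: 'a) \<noteq> pabs (f j)"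
  shows "(\<forall>j\<in>A. pabs (f j) \<le> pabs (sum f A)) \<and> (sum f A = 0 \<or> (\<exists>j\<in>A. pabs (f j) = pabs (sum f A)))"
  using assms
proof (induction A)
  case (insert a A)
  have IH: "\<forall>j\<in>A. pabs (f j) \<le> pabs (sum f A)" "sum f A = 0 \<or> (\<exists>j\<in>A. pabs (f j) = pabs (sum f A))"
    using insert.IH insert.prems by auto
  consider "f a = 0" | "f a \<noteq> 0" "sum f A = 0" | "f a \<noteq> 0" "sum f A \<noteq> 0" by blast
  thus ?case
  proof cases
    case 2
    thus ?thesis using insert.hyps IH(1) order_trans[OF _ pabs_nonneg] by auto
  next
    case 3
    then obtain j where j: "j \<in> A" "pabs (f j) = pabs (sum f A)" using IH by blast
    moreover have "f j \<noteq> 0"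
      using j 3 pabs_eq_0_iff by metis
    ultimately have "pabs (f a) \<noteq> pabs (f j)"
      using 3 insert.hyps by (intro insert.prems) auto
    hence "pabs (f a + sum f A) = max (pabs (f a)) (pabs (sum f A))"
      using j by (intro pabs_add_eq_max) simp
    thus ?thesis using insert.hyps IH j by (auto simp: max_def)
  qed (use insert.hyps IH in auto)
qed simp

section \<open>Limits and series in an ultrametric field\<close>

lemma tendsto_pabs_iff: "f \<longlonglongrightarrow> l \<longleftrightarrow> (\<lambda>n. pabs (f n - l :: 'a)) \<longlonglongrightarrow> 0"
  by (simp add: tendsto_dist_iff[of f] dist_eq)

lemma pabs_limit_le:
  assumes "f \<longlonglongrightarrow> (l :: 'a)" and "\<forall>\<^sub>F n in sequentially. pabs (f n - a) \<le> B"
  shows "pabs (l - a) \<le> B"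
  using tendsto_upperbound[OF tendsto_dist[OF assms(1) tendsto_const[of a]]] assms(2)
  by (simp add: dist_eq)

text \<open>Metric and addition are linked only by \<open>dist_eq\<close> and
  \<open>ultrametric\<close>, so the claim is moved to real sequences of absolute values.\<close>

lemma tendsto_sum_ultrametric:
  assumes "\<And>i. i \<in> A \<Longrightarrow> (\<lambda>n. f i n) \<longlonglongrightarrow> (l i :: 'a)"
  shows "(\<lambda>n. \<Sum>i\<in>A. f i n) \<longlonglongrightarrow> (\<Sum>i\<in>A. l i)"
proof -
  have *: "(\<lambda>n. \<Sum>i\<in>A. pabs (f i n - l i)) \<longlonglongrightarrow> 0"
    using tendsto_sum[of A "\<lambda>i n. pabs (f i n - l i)" "\<lambda>_. 0"] assms by (simp add: tendsto_pabs_iff)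
  have "pabs ((\<Sum>i\<in>A. f i n) - (\<Sum>i\<in>A. l i)) \<le> (\<Sum>i\<in>A. pabs (f i n - l i))" for n
  proof (cases "finite A")
    case True
    show ?thesis unfolding sum_subtractf[symmetric]
      by (rule pabs_sum_le) (auto intro!: member_le_sum sum_nonneg simp: True)
  qed simp
  thus ?thesis unfolding tendsto_pabs_iff
    by (intro tendsto_sandwich[OF _ _ tendsto_const *]) auto
qed

lemma tendsto_mult_const_ultrametric:
  assumes "f \<longlonglongrightarrow> (l :: 'a)"
  shows "(\<lambda>n. f n * c) \<longlonglongrightarrow> l * c"
  using tendsto_mult_right[of "\<lambda>n. pabs (f n - l)" 0 sequentially "pabs c"] assms
  by (simp add: tendsto_pabs_iff pabs_mult flip: left_diff_distrib)

text \<open>A block of terms is no larger than its largest term, so terms tending to 0 already make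
  the partial sums Cauchy.\<close>

lemma sums_ultrametric:
  assumes "complete E" and "0 \<in> E" and "\<And>a b. a \<in> E \<Longrightarrow> b \<in> E \<Longrightarrow> a + b \<in> E"
    and "\<And>n. t n \<in> E" and "(\<lambda>n. pabs (t n :: 'a)) \<longlonglongrightarrow> 0"
  shows "\<exists>l\<in>E. t sums l"
proof -
  have inE: "(\<Sum>n<N. t n) \<in> E" for N
    by (induction N) (use assms in auto)
  have step: "pabs ((\<Sum>n<N + k. t n) - (\<Sum>n<N. t n)) < e"
    if "\<And>n. n \<ge> N \<Longrightarrow> pabs (t n) < e" for N k e
  proof (induction k)
    case 0
    show ?case using that[of N] by (auto intro: le_less_trans[OF pabs_nonneg])
  next
    case (Suc k)
    have "(\<Sum>n<N + Suc k. t n) - (\<Sum>n<N. t n) = ((\<Sum>n<N + k. t n) - (\<Sum>n<N. t n)) + t (N + k)"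
      by simp
    thus ?case using pabs_add_less[OF Suc that[of "N + k"]] by (simp only: le_add1)
  qed
  have "Cauchy (\<lambda>N. \<Sum>n<N. t n)"
    unfolding Cauchy_altdef2
  proof (intro allI impI)
    fix e :: real assume "e > 0"
    then obtain N where N: "\<And>n. n \<ge> N \<Longrightarrow> pabs (t n) < e"
      using LIMSEQ_D[OF assms(5), of e] by auto
    have "dist (\<Sum>n<m. t n) (\<Sum>n<N. t n) < e" if "m \<ge> N" for m
      using step[of N e "m - N", OF N] that by (simp add: dist_eq)
    thus "\<exists>N. \<forall>n\<ge>N. dist (\<Sum>n<n. t n) (\<Sum>n<N. t n) < e" by blast
  qed
  thus ?thesis
    using assms(1) inE unfolding complete_def sums_def by metis
qed

text \<open>Used with A = {0, 1} to split a power series into its linear part and an error bounded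
  term by term.\<close>

lemma sums_pabs_le:
  assumes "t sums (l :: 'a)" and "finite A" and "\<And>n. n \<notin> A \<Longrightarrow> pabs (t n) \<le> B" and "B \<ge> 0"
  shows "pabs (l - sum t A) \<le> B"
proof (rule pabs_limit_le[OF assms(1)[unfolded sums_def]])
  obtain N where N: "\<And>n. n \<in> A \<Longrightarrow> n < N"
    using assms(2) by (auto simp: finite_nat_set_iff_bounded)
  have "pabs ((\<Sum>n<m. t n) - sum t A) \<le> B" if "m \<ge> N" for m
  proof -
    have "A \<subseteq> {..<m}" using N that by fastforce
    hence "(\<Sum>n<m. t n) - sum t A = (\<Sum>n\<in>{..<m} - A. t n)"
      by (simp add: sum_diff)
    thus ?thesis using assms by (auto intro!: pabs_sum_le)
  qed
  thus "\<forall>\<^sub>F n in sequentially. pabs ((\<Sum>n<n. t n) - sum t A) \<le> B"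
    by (auto simp: eventually_at_top_linorder)
qed

end

section \<open>Subfields of the ambient field\<close>

lemma ambient_simps [simp]:
  "carrier (ambient :: 'a::field_char_0 ring) = UNIV"
  "a \<otimes>\<^bsub>ambient\<^esub> b = a * (b :: 'a)" "a \<oplus>\<^bsub>ambient\<^esub> b = a + b"
  "\<one>\<^bsub>ambient\<^esub> = (1 :: 'a)" "\<zero>\<^bsub>ambient\<^esub> = (0 :: 'a)"
  by (simp_all add: ring_of_type_algebra_def)

lemma field_ambient: "Ring.field (ambient :: 'a::field_char_0 ring)"
  by (rule field_from_type_algebra)

lemma ring_ambient: "Ring.ring (ambient :: 'a::field_char_0 ring)"
  by (rule ring_from_type_algebra)

lemma domain_ambient: "Ring.domain (ambient :: 'a::field_char_0 ring)"
  using field_ambient by (rule field.axioms)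

lemma ambient_a_inv [simp]: "\<ominus>\<^bsub>ambient\<^esub> a = - (a :: 'a::field_char_0)"
  using abelian_group.minus_equality[OF ring.is_abelian_group[OF ring_ambient], of "- a" a] by simp

lemma ambient_m_inv [simp]: "a \<noteq> 0 \<Longrightarrow> inv\<^bsub>ambient\<^esub> a = inverse (a :: 'a::field_char_0)"
  using comm_monoid.comm_inv_char[OF cring.axioms(2)[OF cring_from_type_algebra], of a "inverse a"]
  by simp

lemma ambient_combine:
  "length cs = length us \<Longrightarrow>
    ring.combine (ambient :: 'a::field_char_0 ring) cs us = (\<Sum>i<length us. cs ! i * us ! i)"
  by (induction cs us rule: list_induct2) (simp_all add: ring.combine.simps[OF ring_ambient] sum.lessThan_Suc_shift del: sum.lessThan_Suc)

context
  fixes E :: "'a::field_char_0 set"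
  assumes E: "subfield E ambient"
begin

lemma subfield_ambient_simps: "0 \<in> E" "1 \<in> E"
  using subringE[OF subfieldE(1)[OF E]] by simp_all

lemma subfield_ambient_add: "a \<in> E \<Longrightarrow> b \<in> E \<Longrightarrow> a + b \<in> E"
  using subringE(7)[OF subfieldE(1)[OF E]] by simp

lemma subfield_ambient_mult: "a \<in> E \<Longrightarrow> b \<in> E \<Longrightarrow> a * b \<in> E"
  using subringE(6)[OF subfieldE(1)[OF E]] by simp

lemma subfield_ambient_uminus: "a \<in> E \<Longrightarrow> - a \<in> E"
  using subringE(5)[OF subfieldE(1)[OF E], of a] by simp

lemma subfield_ambient_diff: "a \<in> E \<Longrightarrow> b \<in> E \<Longrightarrow> a - b \<in> E"
  using subfield_ambient_add[of a "- b"] subfield_ambient_uminus by simp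

lemma subfield_ambient_inverse: "a \<in> E \<Longrightarrow> inverse a \<in> E"
  using ring.subfield_m_inv(1)[OF ring_ambient E, of a] by (cases "a = 0") (auto simp: subfield_ambient_simps)

lemma subfield_ambient_divide: "a \<in> E \<Longrightarrow> b \<in> E \<Longrightarrow> a / b \<in> E"
  by (simp add: divide_inverse subfield_ambient_mult subfield_ambient_inverse)

lemma subfield_ambient_power: "a \<in> E \<Longrightarrow> a ^ n \<in> E"
  by (induction n) (auto simp: subfield_ambient_simps subfield_ambient_mult)

lemma subfield_ambient_sum: "(\<And>i. i \<in> A \<Longrightarrow> f i \<in> E) \<Longrightarrow> sum f A \<in> E"
  by (induction A rule: infinite_finite_induct)
     (auto simp: subfield_ambient_simps subfield_ambient_add)

lemma subfield_ambient_prod: "(\<And>i. i \<in> A \<Longrightarrow> f i \<in> E) \<Longrightarrow> prod f A \<in> E"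
  by (induction A rule: infinite_finite_induct)
     (auto simp: subfield_ambient_simps subfield_ambient_mult)

lemma subfield_ambient_of_nat: "of_nat n \<in> E"
  by (induction n) (auto simp: subfield_ambient_simps subfield_ambient_add)

lemmas subfield_closed = subfield_ambient_simps subfield_ambient_add subfield_ambient_mult
  subfield_ambient_uminus subfield_ambient_diff subfield_ambient_inverse subfield_ambient_divide
  subfield_ambient_power subfield_ambient_sum subfield_ambient_prod subfield_ambient_of_nat

end

section \<open>The \<open>p\<close>-adic numbers\<close>

context padic
begin

lemma subfield_K: "subfield K ambient"
  using algebraic_closure_K unfolding algebraic_closure_def by blast

lemmas K_closed = subfield_closed[OF subfield_K]

lemma Rats_approx:
  assumes "a \<in> K" "e > 0"
  obtains q where "q \<in> \<rat>" "pabs (q - a) < e"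
  using assms K_subset_closure_Rats closure_approachable[of a \<rat>] by (auto simp: dist_eq)

text \<open>A rational number closer to a than \<open>pabs a\<close> has the same absolute value as
  a, so K has the value group of the rationals.\<close>

lemma pabs_K_eq_powi:
  assumes "a \<in> K" "a \<noteq> 0"
  shows "\<exists>z. pabs a = (1 / real p) powi z"
proof -
  obtain q where q: "q \<in> \<rat>" "pabs (q - a) < pabs a"
    using Rats_approx[of a "pabs a"] assms by auto
  have "pabs q = pabs a"
    using pabs_add_eq_right[OF q(2)] by simp
  moreover obtain m n where mn: "q = of_int m / of_int n" "n > 0"
    using q(1) by (cases rule: Rats_cases') auto
  moreover have "m \<noteq> 0"
    using calculation assms by auto
  ultimately have "pabs a =
      (1 / real p) powi (int (multiplicity (int p) m) - int (multiplicity (int p) n))"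
    using p_gt_1 by (simp add: pabs_divide pabs_int power_int_diff)
  thus ?thesis ..
qed

text \<open>The value group of K is discrete: no value lies strictly between 1/p and 1. This later
  turns strict inequalities into divisibility by p.\<close>

lemma pabs_K_less_1_iff:
  assumes "a \<in> K"
  shows "pabs a < 1 \<longleftrightarrow> pabs a \<le> 1 / real p"
proof
  assume *: "pabs a < 1"
  show "pabs a \<le> 1 / real p"
  proof (cases "a = 0")
    case False
    then obtain z where z: "pabs a = (1 / real p) powi z"
      using pabs_K_eq_powi assms by blast
    have "z > 0"
    proof (rule ccontr)
      assume "\<not> z > 0"
      then obtain n where "z = - int n" by (metis int_cases2 neg_0_less_iff_less not_less_iff_gr_or_eq
            of_nat_0_less_iff of_nat_0 minus_zero neq0_conv)
      moreover have "1 \<le> real p ^ n" using p_gt_1 by (simp add: one_le_power)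
      ultimately show False using z *
        by (simp add: power_int_minus power_one_over)
    qed
    then obtain n where "z = int (Suc n)"
      by (metis zero_less_imp_eq_int gr0_conv_Suc)
    hence "pabs a = (1 / real p) ^ Suc n"
      using z by (simp only: power_int_of_nat)
    also have "\<dots> \<le> (1 / real p) ^ 1"
      using p_gt_1 by (intro power_decreasing) auto
    finally show ?thesis by simp
  qed (use p_gt_1 in auto)
next
  assume "pabs a \<le> 1 / real p"
  also have "\<dots> < 1" using p_gt_1 by simp
  finally show "pabs a < 1" .
qed

lemma int_ring_K_dvd:
  assumes "a \<in> K" "pabs a < 1"
  shows "\<exists>z\<in>int_ring K. a = of_nat p * z"
proof (rule bexI[of _ "a / of_nat p"])
  show "a / of_nat p \<in> int_ring K"
    using assms pabs_K_less_1_iff p_gt_1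
    by (auto simp: int_ring_def K_closed pabs_divide pabs_p field_simps)
qed (use p_gt_1 in auto)

text \<open>Approximate a by a fraction s/t in lowest terms. Integrality keeps p out of t, so t has
  an inverse u modulo p^N, and s * u is an integer close to s/t.\<close>

lemma int_ring_K_approx:
  assumes "a \<in> int_ring K"
  obtains m :: nat where "pabs (a - of_nat m) \<le> (1 / real p) ^ N"
proof -
  have pN: "pabs (of_int (int p ^ N * k) :: 'a) \<le> (1 / real p) ^ N" for k
    using mult_left_le[OF pabs_of_int_le_1[of k], of "(1 / real p) ^ N"] p_gt_1
    by (simp add: pabs_mult pabs_power pabs_p power_one_over)
  have "(1 / real p) ^ N > 0" using p_gt_1 by simp
  then obtain q where q: "q \<in> \<rat>" "pabs (q - a) < (1 / real p) ^ N"
    using Rats_approx[of a "(1 / real p) ^ N"] assms by (auto simp: int_ring_def)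
  have "(1 / real p) ^ N \<le> 1" using p_gt_1 by (simp add: power_le_one)
  hence "pabs q \<le> 1"
    using pabs_add_le[of "q - a" 1 a] q assms by (simp add: int_ring_def)
  obtain s t where st: "t > 0" "coprime s t" "q = of_int s / of_int t"
    using q(1) by (cases rule: Rats_cases') auto
  have "\<not> int p dvd t"
  proof
    assume "int p dvd t"
    hence "\<not> int p dvd s"
      using st(2) prime_p by (meson coprime_common_divisor not_prime_unit prime_nat_int_transfer)
    hence "pabs (of_int s :: 'a) = 1" "pabs (of_int t :: 'a) < 1"
      using pabs_of_int_less_1_iff[of s] pabs_of_int_less_1_iff[of t] pabs_of_int_le_1[of s]
        \<open>int p dvd t\<close> by auto
    hence "pabs q > 1" using st by (simp add: pabs_divide)
    thus False using \<open>pabs q \<le> 1\<close> by simp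
  qed
  hence "coprime t (int p ^ N)"
    using prime_p by (simp add: prime_imp_coprime coprime_commute[of t])
  then obtain u v where uv: "u * t + v * int p ^ N = 1"
    using bezout_int[of t "int p ^ N"] by auto
  \<comment> \<open>Reducing modulo p^N replaces the integer s * u by a natural number without
    leaving the permitted error.\<close>
  define m where "m = nat ((s * u) mod (int p ^ N))"
  have "int m = s * u - int p ^ N * ((s * u) div int p ^ N)"
    using p_gt_1 by (simp add: m_def minus_mult_div_eq_mod)
  hence "(of_int (int m) :: 'a) = of_int (s * u - int p ^ N * ((s * u) div int p ^ N))"
    by (rule arg_cong)
  hence m: "of_nat m = of_int (s * u) - (of_int (int p ^ N * ((s * u) div int p ^ N)) :: 'a)"
    by simp
  have "(of_int u * of_int t + of_int (int p ^ N * v) :: 'a) = 1"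
    using arg_cong[OF uv, of "of_int :: int \<Rightarrow> 'a"] by (simp add: mult.commute)
  hence "q = q * (of_int u * of_int t + of_int (int p ^ N * v))"
    by simp
  also have "\<dots> = q * of_int (int p ^ N * v) + (q * of_int t) * of_int u"
    by (simp only: algebra_simps)
  also have "q * of_int t = of_int s" using st by simp
  finally have "q - of_int (s * u) = q * of_int (int p ^ N * v)"
    unfolding diff_eq_eq by simp
  moreover have "pabs (q * of_int (int p ^ N * v)) \<le> 1 * (1 / real p) ^ N"
    unfolding pabs_mult[of q] using \<open>pabs q \<le> 1\<close> pN by (intro mult_mono) auto
  ultimately have qsu: "pabs (q - of_int (s * u)) \<le> (1 / real p) ^ N" by simp
  have "pabs ((q - of_int (s * u)) + of_int (int p ^ N * ((s * u) div int p ^ N)) - (q - a))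
      \<le> (1 / real p) ^ N"
    by (rule pabs_diff_le[OF pabs_add_le[OF qsu pN] less_imp_le[OF q(2)]])
  moreover have "(q - of_int (s * u)) + of_int (int p ^ N * ((s * u) div int p ^ N)) - (q - a)
      = a - of_nat m"
    by (simp add: m)
  ultimately show ?thesis using that by metis
qed

text \<open>One factor is exchanged at a time; the other factors are integral and do not enlarge the
  error.\<close>

lemma pabs_prod_diff_le:
  assumes "\<And>i. i \<in> A \<Longrightarrow> pabs (f i :: 'a) \<le> 1" "\<And>i. i \<in> A \<Longrightarrow> pabs (g i) \<le> 1"
    and "\<And>i. i \<in> A \<Longrightarrow> pabs (f i - g i) \<le> B" and "B \<ge> 0"
  shows "pabs (prod f A - prod g A) \<le> B"
  using assms
proof (induction A rule: infinite_finite_induct)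
  case (insert a A)
  have "pabs (prod g A) \<le> 1"
    using insert.prems by (auto simp: pabs_prod intro!: prod_le_1)
  hence "pabs ((f a - g a) * prod g A) \<le> B * 1"
    unfolding pabs_mult using insert.prems by (intro mult_mono) auto
  moreover have "pabs (f a * (prod f A - prod g A)) \<le> 1 * B"
    unfolding pabs_mult using insert by (intro mult_mono) auto
  ultimately have "pabs (f a * (prod f A - prod g A) + (f a - g a) * prod g A) \<le> B"
    by (intro pabs_add_le) auto
  thus ?case using insert.hyps by (simp add: algebra_simps)
qed auto

text \<open>For a natural number m the binomial coefficient is an integer. Moving from m to a nearby
  \<gamma> changes the numerator by at most \<open>pabs (fact n)\<close>, which division by n!
  tolerates.\<close>

lemma pabs_gbinomial_le_1:
  assumes "\<gamma> \<in> int_ring K"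
  shows "pabs (\<gamma> gchoose n) \<le> 1"
proof -
  have fact_pos: "pabs (fact n :: 'a) > 0" by simp
  \<comment> \<open>The precision N is chosen to beat the denominator n!.\<close>
  obtain N where N: "(1 / real p) ^ N < pabs (fact n :: 'a)"
    using real_arch_pow_inv[OF fact_pos, of "1 / real p"] p_gt_1 by auto
  obtain m where m: "pabs (\<gamma> - of_nat m) \<le> (1 / real p) ^ N"
    using int_ring_K_approx[OF assms] .
  have \<gamma>: "pabs \<gamma> \<le> 1" using assms by (simp add: int_ring_def)
  have "pabs ((\<Prod>i=0..<n. \<gamma> - of_nat i) - (\<Prod>i=0..<n. of_nat m - of_nat i)) \<le> pabs (fact n :: 'a)"
    using m N \<gamma> by (intro pabs_prod_diff_le) (auto intro!: pabs_diff_le pabs_of_nat_le_1)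
  moreover have "(\<Prod>i=0..<n. of_nat m - of_nat i) = fact n * (of_nat (m choose n) :: 'a)"
    by (simp add: binomial_gbinomial gbinomial_mult_fact)
  moreover have "pabs (fact n * of_nat (m choose n) :: 'a) \<le> pabs (fact n :: 'a)"
    using mult_left_le[OF pabs_of_nat_le_1[of "m choose n"], of "pabs (fact n :: 'a)"]
    by (simp add: pabs_mult)
  ultimately have "pabs (\<Prod>i=0..<n. \<gamma> - of_nat i) \<le> pabs (fact n :: 'a)"
    using pabs_add_le by (metis diff_add_cancel)
  moreover have "pabs (\<Prod>i=0..<n. \<gamma> - of_nat i) = pabs (fact n :: 'a) * pabs (\<gamma> gchoose n)"
    by (simp add: pabs_mult flip: gbinomial_mult_fact)
  ultimately show ?thesis using fact_pos by simp
qed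

end

section \<open>The field generated by a primitive root of unity of order \<open>p\<close>\<close>

locale cyclotomic = padic p K for p :: nat and K :: "'a::{field_char_0, metric_space} set" +
  fixes \<zeta> :: 'a and L :: "'a set"
  assumes primitive_root: "primitive_root_of_unity p (1 + \<zeta>)"
    and L_eq: "L = generate_field ambient (insert \<zeta> K)"
begin

lemma root_power: "(1 + \<zeta>) ^ p = 1"
  using primitive_root by (simp add: primitive_root_of_unity_def)

lemma zeta_nonzero [simp]: "\<zeta> \<noteq> 0"
  using primitive_root p_gt_1 by (auto simp: primitive_root_of_unity_def dest: spec[of _ 1])

text \<open>The powers with exponents below p are p distinct roots of X^p - 1, a polynomial of
  degree p, and hence all of them.\<close>

lemma roots_of_unity:
  assumes "z ^ p = 1"
  shows "\<exists>c. z = (1 + \<zeta>) ^ c"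
proof -
  define P :: "'a poly" where "P = Polynomial.monom 1 p - 1"
  have "degree P = p"
    using p_gt_1 degree_add_eq_left[of "- 1" "Polynomial.monom (1 :: 'a) p"]
    by (simp add: P_def degree_monom_eq)
  hence "P \<noteq> 0" using p_gt_1 by auto
  have P: "poly P w = 0 \<longleftrightarrow> w ^ p = 1" for w
    by (simp add: P_def poly_monom)
  have inj: "inj_on (\<lambda>c. (1 + \<zeta>) ^ c) {..<p}"
  proof (rule linorder_inj_onI')
    fix i j assume ij: "i \<in> {..<p}" "j \<in> {..<p}" "i < j"
    show "(1 + \<zeta>) ^ i \<noteq> (1 + \<zeta>) ^ j"
    proof
      assume "(1 + \<zeta>) ^ i = (1 + \<zeta>) ^ j"
      moreover have "(1 + \<zeta>) ^ j = (1 + \<zeta>) ^ i * (1 + \<zeta>) ^ (j - i)"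
        using ij by (simp flip: power_add)
      moreover have "(1 + \<zeta>) ^ i \<noteq> 0"
        using root_power p_gt_1 by (auto simp: zero_power)
      ultimately have "(1 + \<zeta>) ^ (j - i) = 1" by (metis mult_cancel_left1)
      moreover have "0 < j - i" "j - i < p" using ij by auto
      ultimately show False
        using primitive_root unfolding primitive_root_of_unity_def by blast
    qed
  qed
  have "(\<lambda>c. (1 + \<zeta>) ^ c) ` {..<p} = {w. poly P w = 0}"
  proof (rule card_subset_eq)
    show "finite {w. poly P w = 0}"
      using \<open>P \<noteq> 0\<close> by (rule poly_roots_finite)
    show *: "(\<lambda>c. (1 + \<zeta>) ^ c) ` {..<p} \<subseteq> {w. poly P w = 0}"
    proof clarify
      fix c
      have "((1 + \<zeta>) ^ c) ^ p = ((1 + \<zeta>) ^ p) ^ c"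
        by (simp only: mult.commute flip: power_mult)
      thus "poly P ((1 + \<zeta>) ^ c) = 0" by (simp add: P root_power)
    qed
    show "card ((\<lambda>c. (1 + \<zeta>) ^ c) ` {..<p}) = card {w. poly P w = 0}"
      using card_poly_roots_bound[OF \<open>P \<noteq> 0\<close>] card_mono[OF poly_roots_finite[OF \<open>P \<noteq> 0\<close>] *]
      by (simp add: card_image[OF inj] \<open>degree P = p\<close>)
  qed
  moreover have "z \<in> {w. poly P w = 0}" using assms by (simp add: P)
  ultimately show ?thesis by blast
qed

section \<open>The binomial expansion of a p-th power and the size of \<zeta>\<close>

definition middle :: "'a \<Rightarrow> 'a" where
  "middle b = (\<Sum>k\<in>{2..<p}. of_nat (p choose k) * b ^ k)"

lemma power_p_expansion: "(1 + b) ^ p = 1 + of_nat p * b + middle b + b ^ p"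
proof -
  have "{..p} = insert 0 (insert 1 (insert p {2..<p}))"
    using p_gt_1 by auto
  thus ?thesis
    using binomial_ring[of b 1 p] p_gt_1 by (simp add: middle_def add.commute add.left_commute)
qed

text \<open>The prime p divides every inner binomial coefficient, and every power of b here is at
  least the second.\<close>

lemma pabs_middle_le:
  assumes "pabs b \<le> 1"
  shows "pabs (middle b) \<le> pabs b ^ 2 / real p"
  unfolding middle_def
proof (rule pabs_sum_le)
  fix k assume k: "k \<in> {2..<p}"
  hence "p dvd (p choose k)"
    using prime_p p_gt_1 by (intro dvd_choose_prime) auto
  hence "pabs (of_nat (p choose k) :: 'a) * pabs (b ^ k) \<le> 1 / real p * pabs b ^ 2"
    using k assms pabs_of_nat_dvd_le
    by (intro mult_mono) (auto simp: pabs_power intro!: power_decreasing)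
  thus "pabs (of_nat (p choose k) * b ^ k) \<le> pabs b ^ 2 / real p"
    by (simp add: pabs_mult)
qed simp

lemma zeta_power_p: "\<zeta> ^ p = - (of_nat p * \<zeta> + middle \<zeta>)"
  unfolding eq_neg_iff_add_eq_0 using power_p_expansion[of \<zeta>] root_power by (simp add: add_ac)

text \<open>The root of unity has absolute value 1, so \<zeta> is integral; then both terms on the
  right of \<open>zeta_power_p\<close> carry a factor p.\<close>

lemma pabs_zeta_less_1: "pabs \<zeta> < 1"
proof -
  have "pabs (1 + \<zeta>) ^ p = 1"
    using root_power by (simp flip: pabs_power)
  hence "pabs (1 + \<zeta>) = 1"
    using p_gt_1 by (intro power_eq_imp_eq_base[of "pabs (1 + \<zeta>)" p 1]) auto
  hence le: "pabs \<zeta> \<le> 1"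
    using pabs_diff_le[of "1 + \<zeta>" 1 1] by simp
  have "pabs (middle \<zeta>) \<le> 1 / real p"
    using pabs_middle_le[OF le] le p_gt_1 power_le_one[of "pabs \<zeta>" 2] by (simp add: field_simps)
  moreover have "pabs (of_nat p * \<zeta>) \<le> 1 / real p"
    using le p_gt_1 by (simp add: pabs_mult pabs_p field_simps)
  ultimately have "pabs (\<zeta> ^ p) \<le> 1 / real p"
    unfolding zeta_power_p pabs_minus by (intro pabs_add_le)
  also have "\<dots> < 1" using p_gt_1 by simp
  finally show ?thesis
    using le by (cases "pabs \<zeta> = 1") (auto simp: pabs_power)
qed

lemma pabs_zeta_pos: "pabs \<zeta> > 0"
  by simp

lemma pabs_middle_zeta_less: "pabs (middle \<zeta>) < pabs (of_nat p * \<zeta>)"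
proof -
  have "pabs (middle \<zeta>) \<le> pabs \<zeta> ^ 2 / real p"
    using pabs_zeta_less_1 by (intro pabs_middle_le) simp
  also have "\<dots> < pabs \<zeta> / real p"
    using pabs_zeta_less_1 p_gt_1 by (simp add: power2_eq_square divide_strict_right_mono)
  finally show ?thesis by (simp add: pabs_mult pabs_p)
qed

text \<open>In \<open>zeta_power_p\<close> the term p * \<zeta> dominates, and one factor \<zeta>
  cancels. This is total ramification of L over K in numerical form.\<close>

lemma pabs_zeta_power: "pabs \<zeta> ^ (p - 1) = 1 / real p"
proof -
  have "pabs (\<zeta> ^ p) = pabs (of_nat p * \<zeta>)"
    unfolding zeta_power_p pabs_minus
    using pabs_add_eq_right[OF pabs_middle_zeta_less] by (simp add: add.commute)
  hence "pabs \<zeta> ^ (p - 1) * pabs \<zeta> = 1 / real p * pabs \<zeta>"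
    using p_gt_1 by (simp add: pabs_mult pabs_p pabs_power flip: power_Suc2)
  thus ?thesis
    using pabs_zeta_pos by (subst (asm) mult_right_cancel) auto
qed

text \<open>Since \<open>\<zeta> ^ p\<close> is \<open>- p * \<zeta>\<close> up to smaller terms, \<open>[p]\<close> is the Artin--Schreier
  map \<open>s - s ^ p\<close> to leading order.\<close>

lemma power_p_leading_term:
  assumes "pabs s \<le> 1"
  shows "pabs ((1 + \<zeta> * s) ^ p - 1 - of_nat p * \<zeta> * (s - s ^ p)) < pabs (of_nat p * \<zeta>)"
proof -
  \<comment> \<open>Substituting \<open>zeta_power_p\<close> cancels both terms with the exact
    factor p * \<zeta>; only the two middle parts survive.\<close>
  have "(1 + \<zeta> * s) ^ p - 1 - of_nat p * \<zeta> * (s - s ^ p) = middle (\<zeta> * s) - s ^ p * middle \<zeta>"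
    unfolding power_p_expansion power_mult_distrib zeta_power_p by (simp add: algebra_simps)
  moreover have "pabs (\<zeta> * s) \<le> pabs \<zeta>"
    using assms by (simp add: pabs_mult mult_left_le)
  hence "pabs (middle (\<zeta> * s)) \<le> pabs \<zeta> ^ 2 / real p"
    using pabs_zeta_less_1 pabs_middle_le[of "\<zeta> * s"]
    by (meson divide_right_mono less_eq_real_def of_nat_0_le_iff order_trans pabs_nonneg power_mono)
  hence "pabs (middle (\<zeta> * s)) < pabs (of_nat p * \<zeta>)"
    using pabs_zeta_less_1 p_gt_1
    by (elim le_less_trans) (simp add: power2_eq_square divide_strict_right_mono pabs_mult pabs_p)
  moreover have "pabs (s ^ p * middle \<zeta>) \<le> pabs (middle \<zeta>)"
    using assms by (simp add: pabs_mult pabs_power mult_left_le_one_le power_le_one)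
  hence "pabs (s ^ p * middle \<zeta>) < pabs (of_nat p * \<zeta>)"
    using pabs_middle_zeta_less by simp
  ultimately show ?thesis by (simp add: pabs_diff_less)
qed

section \<open>Absolute values of K-linear combinations of powers of \<zeta>\<close>

lemma pabs_zeta_powi_inj: "pabs \<zeta> powi m = pabs \<zeta> powi n \<longleftrightarrow> m = n"
  using power_int_strict_decreasing[OF _ pabs_zeta_pos pabs_zeta_less_1, of m n]
    power_int_strict_decreasing[OF _ pabs_zeta_pos pabs_zeta_less_1, of n m]
  by (cases m n rule: linorder_cases) auto

text \<open>Measured in powers of \<open>pabs \<zeta>\<close>, elements of K have exponents
  divisible by p - 1, so the exponent of the product modulo p - 1 remembers i.\<close>

lemma pabs_K_mult_zeta_power:
  assumes "a \<in> K" "a \<noteq> 0"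
  shows "\<exists>z. pabs (a * \<zeta> ^ i) = pabs \<zeta> powi (int (p - 1) * z + int i)"
proof -
  obtain z where "pabs a = (1 / real p) powi z"
    using pabs_K_eq_powi[OF assms] by blast
  also have "\<dots> = pabs \<zeta> powi (int (p - 1) * z)"
    by (simp only: power_int_mult power_int_of_nat pabs_zeta_power)
  finally show ?thesis
    by (auto simp: pabs_mult pabs_power power_int_add)
qed

text \<open>The exponents of the terms lie in different classes modulo p - 1, so
  \<open>pabs_sum_dominant\<close> applies. The first part bounds coefficients, the second describes
  the value group of L.\<close>

lemma pabs_zeta_sum:
  assumes "\<And>i. a i \<in> K"
  shows "\<forall>j<p - 1. pabs (a j * \<zeta> ^ j) \<le> pabs (\<Sum>i<p - 1. a i * \<zeta> ^ i)"
    and "(\<Sum>i<p - 1. a i * \<zeta> ^ i) = 0 \<or> (\<exists>n. pabs (\<Sum>i<p - 1. a i * \<zeta> ^ i) = pabs \<zeta> powi n)"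
proof -
  have *: "(\<forall>j\<in>{..<p - 1}. pabs (a j * \<zeta> ^ j) \<le> pabs (\<Sum>i<p - 1. a i * \<zeta> ^ i)) \<and>
      ((\<Sum>i<p - 1. a i * \<zeta> ^ i) = 0 \<or>
       (\<exists>j\<in>{..<p - 1}. pabs (a j * \<zeta> ^ j) = pabs (\<Sum>i<p - 1. a i * \<zeta> ^ i)))"
  proof (rule pabs_sum_dominant)
    fix i j assume ij: "i \<in> {..<p - 1}" "j \<in> {..<p - 1}" "i \<noteq> j" "a i * \<zeta> ^ i \<noteq> 0" "a j * \<zeta> ^ j \<noteq> 0"
    obtain y z where "pabs (a i * \<zeta> ^ i) = pabs \<zeta> powi (int (p - 1) * y + int i)"
        "pabs (a j * \<zeta> ^ j) = pabs \<zeta> powi (int (p - 1) * z + int j)"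
      using pabs_K_mult_zeta_power[OF assms, of i i] pabs_K_mult_zeta_power[OF assms, of j j] ij by auto
    moreover have "int (p - 1) * y + int i \<noteq> int (p - 1) * z + int j"
    proof
      assume "int (p - 1) * y + int i = int (p - 1) * z + int j"
      hence "(int (p - 1) * y + int i) mod int (p - 1) = (int (p - 1) * z + int j) mod int (p - 1)"
        by simp
      thus False using ij by (simp flip: of_nat_mod)
    qed
    ultimately show "pabs (a i * \<zeta> ^ i) \<noteq> pabs (a j * \<zeta> ^ j)"
      by (simp only: pabs_zeta_powi_inj not_False_eq_True)
  qed simp
  show "\<forall>j<p - 1. pabs (a j * \<zeta> ^ j) \<le> pabs (\<Sum>i<p - 1. a i * \<zeta> ^ i)"
    using * by auto
  show "(\<Sum>i<p - 1. a i * \<zeta> ^ i) = 0 \<or> (\<exists>n. pabs (\<Sum>i<p - 1. a i * \<zeta> ^ i) = pabs \<zeta> powi n)"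
  proof (rule disjE[OF conjunct2[OF *]])
    assume "\<exists>j\<in>{..<p - 1}. pabs (a j * \<zeta> ^ j) = pabs (\<Sum>i<p - 1. a i * \<zeta> ^ i)"
    then obtain j where j: "pabs (a j * \<zeta> ^ j) = pabs (\<Sum>i<p - 1. a i * \<zeta> ^ i)" by blast
    show ?thesis
    proof (cases "a j = 0")
      case True
      thus ?thesis using j by simp
    next
      case False
      thus ?thesis using pabs_K_mult_zeta_power[OF assms, of j j] j by auto
    qed
  qed blast
qed

section \<open>Coordinates of L with respect to powers of \<zeta>\<close>

lemma subfield_L: "subfield L ambient"
  unfolding L_eq by (rule field.generate_field_is_subfield[OF field_ambient]) simp

lemmas L_closed = subfield_closed[OF subfield_L]

lemma zeta_in_L [simp]: "\<zeta> \<in> L"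
  unfolding L_eq by (rule generate_field.incl) simp

lemma K_subset_L: "K \<subseteq> L"
  unfolding L_eq by (auto intro: generate_field.incl)

lemma algebraic_zeta: "(ring.algebraic ambient over K) \<zeta>"
  using algebraic_closure.algebraic_extension[OF algebraic_closure_K, of \<zeta>] by simp

lemma L_eq_simple_extension: "L = ring.simple_extension ambient K \<zeta>"
proof
  have "subfield (ring.simple_extension ambient K \<zeta>) ambient"
    using domain.simple_extension_is_subfield[OF domain_ambient subfield_K] algebraic_zeta by simp
  thus "L \<subseteq> ring.simple_extension ambient K \<zeta>"
    unfolding L_eq
    using ring.simple_extension_incl[OF ring_ambient, of K \<zeta>]
      ring.simple_extension_mem[OF ring_ambient subfieldE(1)[OF subfield_K], of \<zeta>]
    by (intro field.generate_field_min_subfield1[OF field_ambient]) auto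
  show "ring.simple_extension ambient K \<zeta> \<subseteq> L"
    using K_subset_L
    by (intro ring.simple_extension_subring_incl[OF ring_ambient subfieldE(1)[OF subfield_L]]) auto
qed

lemma finite_dimension_L: "ring.finite_dimension ambient K L"
  unfolding L_eq_simple_extension
  using domain.finite_dimension_simple_extension[OF domain_ambient subfield_K] algebraic_zeta by simp

text \<open>Expand (1 + \<zeta>)^p = 1 and divide by \<zeta>: this is a monic equation of degree p -
  1 for \<zeta> over K.\<close>

lemma zeta_power_reduce: "\<zeta> ^ (p - 1) = - (\<Sum>i<p - 1. of_nat (p choose Suc i) * \<zeta> ^ i)"
proof -
  have "1 = (\<Sum>i\<le>Suc (p - 1). of_nat (p choose i) * \<zeta> ^ i)"
    using binomial_ring[of \<zeta> 1 p] root_power p_gt_1 by (simp add: add.commute)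
  also have "\<dots> = 1 + \<zeta> * (\<Sum>i\<le>p - 1. of_nat (p choose Suc i) * \<zeta> ^ i)"
    by (subst sum.atMost_Suc_shift) (simp add: sum_distrib_left algebra_simps)
  finally have "(\<Sum>i\<le>p - 1. of_nat (p choose Suc i) * \<zeta> ^ i) = 0" by simp
  moreover have "(\<Sum>i\<le>n. f i) = (\<Sum>i<n. f i) + f n" for f :: "nat \<Rightarrow> 'a" and n
    by (simp flip: lessThan_Suc_atMost)
  ultimately have "(\<Sum>i<p - 1. of_nat (p choose Suc i) * \<zeta> ^ i) + \<zeta> ^ (p - 1) = 0"
    using p_gt_1 by simp
  thus ?thesis
    by (simp add: eq_neg_iff_add_eq_0 add.commute)
qed

text \<open>The induction builds polynomials in \<zeta> by Horner's scheme, so only multiplication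
  by \<zeta> followed by addition of a constant has to be treated.\<close>

lemma L_expansion:
  assumes "a \<in> L"
  shows "\<exists>c. (\<forall>i. c i \<in> K) \<and> a = (\<Sum>i<p - 1. c i * \<zeta> ^ i)"
  using assms unfolding L_eq_simple_extension
proof (induct rule: ring.simple_extension.induct[OF ring_ambient, consumes 1, case_names zero lin])
  case zero
  show ?case by (rule exI[of _ "\<lambda>_. 0"]) (simp add: K_closed)
next
  case (lin a k)
  then obtain c where c: "\<forall>i. c i \<in> K" "a = (\<Sum>i<p - 1. c i * \<zeta> ^ i)" by blast
  obtain q where q: "p - 1 = Suc q" using p_gt_1 by (cases "p - 1") auto
  \<comment> \<open>The coefficients move up one place, k enters at place 0, and the overflow c q *
    \<zeta>^(p - 1) is redistributed by \<open>zeta_power_reduce\<close>.\<close>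
  define d where "d i = (case i of 0 \<Rightarrow> k | Suc j \<Rightarrow> c j) - c q * of_nat (p choose Suc i)" for i
  have "d i \<in> K" for i
    using c lin by (auto simp: d_def K_closed split: nat.split)
  moreover have "a * \<zeta> + k = (\<Sum>i<p - 1. d i * \<zeta> ^ i)"
  proof -
    have "a * \<zeta> = (\<Sum>i<q. c i * \<zeta> ^ Suc i) + c q * \<zeta> ^ (p - 1)"
      unfolding c(2) q by (simp add: distrib_left sum_distrib_left mult_ac)
    moreover have "(\<Sum>i<p - 1. (case i of 0 \<Rightarrow> k | Suc j \<Rightarrow> c j) * \<zeta> ^ i) = k + (\<Sum>i<q. c i * \<zeta> ^ Suc i)"
      unfolding q by (simp add: sum.lessThan_Suc_shift del: sum.lessThan_Suc)
    moreover have "c q * \<zeta> ^ (p - 1) = - (\<Sum>i<p - 1. c q * of_nat (p choose Suc i) * \<zeta> ^ i)"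
      by (subst zeta_power_reduce) (simp add: sum_distrib_left mult.assoc)
    ultimately show ?thesis
      by (simp add: d_def left_diff_distrib sum_subtractf del: One_nat_def)
  qed
  ultimately show ?case by auto
qed

text \<open>Only the values at indices below p - 1 are constrained by the sum. Membership in K is
  demanded at every index, so that it can be used without a range condition.\<close>

definition zeta_coeff :: "'a \<Rightarrow> nat \<Rightarrow> 'a" where
  "zeta_coeff a = (SOME c. (\<forall>i. c i \<in> K) \<and> a = (\<Sum>i<p - 1. c i * \<zeta> ^ i))"

lemma zeta_coeff_in_K: "a \<in> L \<Longrightarrow> zeta_coeff a i \<in> K"
  and zeta_coeff_sum: "a \<in> L \<Longrightarrow> (\<Sum>i<p - 1. zeta_coeff a i * \<zeta> ^ i) = a"
  using someI_ex[OF L_expansion[of a]] unfolding zeta_coeff_def by auto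

lemma pabs_zeta_coeff_le: "a \<in> L \<Longrightarrow> j < p - 1 \<Longrightarrow> pabs (zeta_coeff a j) * pabs \<zeta> ^ j \<le> pabs a"
  using pabs_zeta_sum(1)[of "zeta_coeff a"] zeta_coeff_in_K zeta_coeff_sum by (simp add: pabs_mult pabs_power)

text \<open>The difference of two expansions has sum 0, and each of its terms is at most as large as
  the sum. Linear independence thus comes from absolute values, not from irreducibility of a
  polynomial.\<close>

lemma zeta_coeff_eqI:
  assumes "\<And>i. c i \<in> K" and "a = (\<Sum>i<p - 1. c i * \<zeta> ^ i)" and "j < p - 1"
  shows "zeta_coeff a j = c j"
proof -
  have "a \<in> L" using assms K_subset_L by (auto simp: L_closed subset_iff)
  moreover have "(\<Sum>i<p - 1. (zeta_coeff a i - c i) * \<zeta> ^ i) = (\<Sum>i<p - 1. zeta_coeff a i * \<zeta> ^ i) - a"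
    unfolding assms(2) by (simp add: left_diff_distrib sum_subtractf)
  ultimately have "pabs ((zeta_coeff a j - c j) * \<zeta> ^ j) \<le> 0"
    using pabs_zeta_sum(1)[of "\<lambda>i. zeta_coeff a i - c i"] assms(1,3) zeta_coeff_in_K zeta_coeff_sum
    by (simp add: K_closed)
  hence "pabs ((zeta_coeff a j - c j) * \<zeta> ^ j) = 0"
    by (rule antisym) simp
  thus ?thesis by simp
qed

lemma zeta_coeff_lincomb:
  assumes "\<And>i. i \<in> A \<Longrightarrow> k i \<in> K" "\<And>i. i \<in> A \<Longrightarrow> f i \<in> L" "j < p - 1"
  shows "zeta_coeff (\<Sum>i\<in>A. k i * f i) j = (\<Sum>i\<in>A. k i * zeta_coeff (f i) j)"
proof (rule zeta_coeff_eqI)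
  have "(\<Sum>i\<in>A. k i * f i) = (\<Sum>i\<in>A. k i * (\<Sum>j<p - 1. zeta_coeff (f i) j * \<zeta> ^ j))"
    using assms by (intro sum.cong) (simp_all only: zeta_coeff_sum)
  also have "\<dots> = (\<Sum>j<p - 1. (\<Sum>i\<in>A. k i * zeta_coeff (f i) j) * \<zeta> ^ j)"
    by (simp add: sum_distrib_left sum_distrib_right mult.assoc) (rule sum.swap)
  finally show "(\<Sum>i\<in>A. k i * f i) = (\<Sum>j<p - 1. (\<Sum>i\<in>A. k i * zeta_coeff (f i) j) * \<zeta> ^ j)" .
qed (use assms in \<open>auto intro!: K_closed zeta_coeff_in_K\<close>)

section \<open>Value group, prime element and residue field of L\<close>

lemma pabs_L_less_1:
  assumes "a \<in> L" "pabs a < 1"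
  shows "pabs a \<le> pabs \<zeta>"
proof (cases "a = 0")
  case False
  then obtain n where n: "pabs a = pabs \<zeta> powi n"
    using pabs_zeta_sum(2)[of "zeta_coeff a"] zeta_coeff_in_K zeta_coeff_sum assms(1) by auto
  have "n \<ge> 1"
  proof (rule ccontr)
    assume "\<not> n \<ge> 1"
    hence "pabs \<zeta> powi 0 \<le> pabs \<zeta> powi n"
      using pabs_zeta_less_1 by (intro power_int_decreasing) auto
    thus False using n assms by simp
  qed
  hence "pabs \<zeta> powi n \<le> pabs \<zeta> powi 1"
    using pabs_zeta_less_1 by (intro power_int_decreasing) auto
  thus ?thesis using n by simp
qed simp

lemma prime_element_zeta: "prime_element L \<zeta>"
  unfolding prime_element_def
proof safe
  fix a assume a: "a \<in> max_ideal L"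
  hence "a / \<zeta> \<in> int_ring L"
    using pabs_L_less_1[of a] by (auto simp: max_ideal_def int_ring_def L_closed pabs_divide field_simps)
  thus "a \<in> (*) \<zeta> ` int_ring L"
    by (intro image_eqI[of _ _ "a / \<zeta>"]) auto
next
  fix a assume "a \<in> int_ring L"
  moreover from this have "pabs (\<zeta> * a) \<le> pabs \<zeta>"
    by (simp add: int_ring_def pabs_mult mult_left_le)
  ultimately show "\<zeta> * a \<in> max_ideal L"
    using pabs_zeta_less_1 by (auto simp: int_ring_def max_ideal_def L_closed)
qed simp

text \<open>An integral element has integral coefficients, so modulo \<zeta> only the constant one
  remains, and that is congruent modulo p to a natural number.\<close>

lemma int_ring_L_residue:
  assumes "a \<in> int_ring L"
  shows "\<exists>i<p. pabs (a - of_nat i) < 1"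
proof -
  have a: "a \<in> L" "pabs a \<le> 1" using assms by (auto simp: int_ring_def)
  have int: "pabs (zeta_coeff a i) \<le> 1" if "i < p - 1" for i
  proof -
    \<comment> \<open>The bound from \<open>pabs_zeta_coeff_le\<close> alone allows a small
      denominator. After multiplication by p it is strict, and discreteness of the values of K
      improves it to integrality.\<close>
    have "pabs (of_nat p * zeta_coeff a i) * pabs \<zeta> ^ i < pabs \<zeta> ^ i"
    proof -
      have "pabs (of_nat p * zeta_coeff a i) * pabs \<zeta> ^ i \<le> 1 / real p * 1"
        unfolding pabs_mult pabs_p mult.assoc
        using pabs_zeta_coeff_le[OF a(1) that] a(2) by (intro mult_left_mono) auto
      also have "\<dots> = pabs \<zeta> ^ (p - 1)" by (simp only: pabs_zeta_power mult_1_right)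
      also have "\<dots> < pabs \<zeta> ^ i"
        using that pabs_zeta_less_1 by (intro power_strict_decreasing) auto
      finally show ?thesis .
    qed
    hence "pabs (of_nat p * zeta_coeff a i) < 1" by simp
    hence "pabs (of_nat p * zeta_coeff a i) \<le> 1 / real p"
      using pabs_K_less_1_iff[of "of_nat p * zeta_coeff a i"] a by (simp add: K_closed zeta_coeff_in_K)
    thus ?thesis using p_gt_1 by (simp add: pabs_mult pabs_p field_simps)
  qed
  \<comment> \<open>This splits off the constant coefficient; for p = 2 the remaining sum is
    empty.\<close>
  have p1: "p - 1 = Suc (p - 2)" using p_gt_1 by simp
  have "a = zeta_coeff a 0 + (\<Sum>i<p - 2. zeta_coeff a (Suc i) * \<zeta> ^ Suc i)"
    using zeta_coeff_sum[OF a(1)] unfolding p1 by (simp add: sum.lessThan_Suc_shift del: sum.lessThan_Suc)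
  moreover have "pabs (\<Sum>i<p - 2. zeta_coeff a (Suc i) * \<zeta> ^ Suc i) < 1"
  proof (rule pabs_sum_less)
    fix i assume "i \<in> {..<p - 2}"
    hence "pabs (zeta_coeff a (Suc i)) \<le> 1" by (intro int) auto
    hence "pabs (zeta_coeff a (Suc i)) * pabs \<zeta> ^ Suc i \<le> pabs \<zeta> ^ Suc i"
      by (intro mult_left_le_one_le) auto
    also have "\<dots> < 1" using pabs_zeta_less_1 by (intro power_Suc_less_one) auto
    finally show "pabs (zeta_coeff a (Suc i) * \<zeta> ^ Suc i) < 1" by (simp add: pabs_mult pabs_power)
  qed simp
  ultimately have res: "pabs (a - zeta_coeff a 0) < 1"
    by (metis add_diff_cancel_left')
  have "zeta_coeff a 0 \<in> int_ring K"
    using int[of 0] p1 zeta_coeff_in_K[OF a(1)] by (simp add: int_ring_def)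
  then obtain m where "pabs (zeta_coeff a 0 - of_nat m) \<le> (1 / real p) ^ 1"
    using int_ring_K_approx by blast
  hence "pabs (zeta_coeff a 0 - of_nat m) < 1" using p_gt_1 by (elim le_less_trans) simp
  moreover have "pabs (of_nat (p * (m div p)) :: 'a) < 1"
    by (rule le_less_trans[OF pabs_of_nat_dvd_le]) (use p_gt_1 in auto)
  hence "pabs (of_nat p * of_nat (m div p) :: 'a) < 1" by simp
  ultimately have "pabs ((a - zeta_coeff a 0) + (zeta_coeff a 0 - of_nat m) + of_nat p * of_nat (m div p)) < 1"
    using res by (intro pabs_add_less)
  also have "(of_nat m :: 'a) = of_nat p * of_nat (m div p) + of_nat (m mod p)"
    by (simp flip: of_nat_mult of_nat_add)
  finally have "pabs (a - of_nat (m mod p)) < 1" by (simp add: algebra_simps)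
  thus ?thesis using p_gt_1 by (intro exI[of _ "m mod p"]) auto
qed

text \<open>This makes the exponent in \<open>is_frobenius\<close> equal to p, the one occurring in
  the leading term of [p].\<close>

lemma residue_card_L: "residue_card L = p"
proof -
  define R where "R = {(a, b). a \<in> int_ring L \<and> b \<in> int_ring L \<and> a - b \<in> max_ideal L}"
  have R: "(a, b) \<in> R \<longleftrightarrow> a \<in> int_ring L \<and> b \<in> int_ring L \<and> pabs (a - b) < 1" for a b
    by (auto simp: R_def int_ring_def max_ideal_def L_closed)
  have of_nat: "of_nat i \<in> int_ring L" for i
    by (simp add: int_ring_def L_closed pabs_of_nat_le_1)
  have trans: "pabs (a - c) < 1" if "pabs (a - b) < 1" "pabs (b - c) < 1" for a b c :: 'a
    using pabs_add_less[OF that] by simp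
  have "equiv (int_ring L) R"
    by (rule equivI) (auto simp: R refl_on_def sym_def trans_def pabs_minus_commute intro: trans)
  have class_eq: "R `` {a} = R `` {b} \<longleftrightarrow> pabs (a - b) < 1" if "a \<in> int_ring L" "b \<in> int_ring L" for a b
    using eq_equiv_class_iff[OF \<open>equiv (int_ring L) R\<close> that] that by (simp add: R)
  have "bij_betw (\<lambda>i. R `` {of_nat i}) {..<p} (int_ring L // R)"
    unfolding bij_betw_def
  proof
    show "inj_on (\<lambda>i. R `` {of_nat i}) {..<p}"
    proof (rule inj_onI)
      fix i j assume ij: "i \<in> {..<p}" "j \<in> {..<p}" "R `` {of_nat i} = R `` {of_nat j}"
      hence "pabs (of_int (int i - int j) :: 'a) < 1"
        using class_eq[OF of_nat of_nat] by simp
      hence "int p dvd int i - int j" by (simp only: pabs_of_int_less_1_iff)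
      hence "int i mod int p = int j mod int p" by (simp add: mod_eq_dvd_iff)
      thus "i = j" using ij by simp
    qed
    show "(\<lambda>i. R `` {of_nat i}) ` {..<p} = int_ring L // R"
    proof
      show "(\<lambda>i. R `` {of_nat i}) ` {..<p} \<subseteq> int_ring L // R"
        using of_nat by (auto intro: quotientI)
      show "int_ring L // R \<subseteq> (\<lambda>i. R `` {of_nat i}) ` {..<p}"
      proof
        fix C assume "C \<in> int_ring L // R"
        then obtain a where a: "a \<in> int_ring L" "C = R `` {a}" by (rule quotientE)
        then obtain i where "i < p" "pabs (a - of_nat i) < 1"
          using int_ring_L_residue by blast
        thus "C \<in> (\<lambda>i. R `` {of_nat i}) ` {..<p}"
          using class_eq[OF a(1) of_nat] a(2) by blast
      qed
    qed
  qed
  thus ?thesis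
    unfolding residue_card_def R_def[symmetric] using bij_betw_same_card by fastforce
qed

section \<open>Completeness of L\<close>

lemma zeta_coeff_diff:
  assumes "a \<in> L" "b \<in> L" "j < p - 1"
  shows "zeta_coeff (a - b) j = zeta_coeff a j - zeta_coeff b j"
proof (rule zeta_coeff_eqI)
  show "a - b = (\<Sum>i<p - 1. (zeta_coeff a i - zeta_coeff b i) * \<zeta> ^ i)"
    using assms by (simp only: left_diff_distrib sum_subtractf zeta_coeff_sum)
qed (use assms in \<open>auto intro!: K_closed zeta_coeff_in_K\<close>)

text \<open>Each coordinate is bounded by a fixed multiple of the absolute value, so Cauchy
  sequences converge coordinatewise in K.\<close>

lemma complete_L: "complete L"
  unfolding complete_def
proof (intro allI impI, elim conjE)
  fix f assume f: "\<forall>n. f n \<in> L" "Cauchy f"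
  have "\<exists>l\<in>K. (\<lambda>n. zeta_coeff (f n) j) \<longlonglongrightarrow> l" if j: "j < p - 1" for j
  proof -
    have "Cauchy (\<lambda>n. zeta_coeff (f n) j)"
      unfolding Cauchy_def
    proof (intro allI impI)
      fix e :: real assume "e > 0"
      hence "e * pabs \<zeta> ^ j > 0" by simp
      then obtain N where N: "\<And>m n. m \<ge> N \<Longrightarrow> n \<ge> N \<Longrightarrow> dist (f m) (f n) < e * pabs \<zeta> ^ j"
        using f(2) unfolding Cauchy_def by blast
      have "dist (zeta_coeff (f m) j) (zeta_coeff (f n) j) < e" if "m \<ge> N" "n \<ge> N" for m n
      proof -
        have "pabs (zeta_coeff (f m) j - zeta_coeff (f n) j) * pabs \<zeta> ^ j \<le> pabs (f m - f n)"
          using pabs_zeta_coeff_le[of "f m - f n" j] f(1) j by (simp add: zeta_coeff_diff L_closed)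
        also have "\<dots> < e * pabs \<zeta> ^ j" using N[OF that] by (simp add: dist_eq)
        finally show ?thesis by (simp add: dist_eq)
      qed
      thus "\<exists>M. \<forall>m\<ge>M. \<forall>n\<ge>M. dist (zeta_coeff (f m) j) (zeta_coeff (f n) j) < e" by blast
    qed
    thus ?thesis
      using complete_K[unfolded complete_def, rule_format, of "\<lambda>n. zeta_coeff (f n) j"]
        f(1) zeta_coeff_in_K by simp
  qed
  then obtain l where l: "\<And>j. j < p - 1 \<Longrightarrow> l j \<in> K \<and> (\<lambda>n. zeta_coeff (f n) j) \<longlonglongrightarrow> l j"
    by metis
  have "(\<lambda>n. \<Sum>j<p - 1. zeta_coeff (f n) j * \<zeta> ^ j) \<longlonglongrightarrow> (\<Sum>j<p - 1. l j * \<zeta> ^ j)"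
    using l by (intro tendsto_sum_ultrametric tendsto_mult_const_ultrametric) auto
  hence "f \<longlonglongrightarrow> (\<Sum>j<p - 1. l j * \<zeta> ^ j)"
    using f(1) by (simp only: zeta_coeff_sum)
  moreover have "(\<Sum>j<p - 1. l j * \<zeta> ^ j) \<in> L"
    using l K_subset_L by (auto intro!: L_closed)
  ultimately show "\<exists>l\<in>L. f \<longlonglongrightarrow> l" by blast
qed

section \<open>Leading terms of the series for [\<gamma>] and the logarithm\<close>

lemma suminf_L:
  assumes "\<And>n. t n \<in> L" "\<And>n. pabs (t n) \<le> B * pabs \<zeta> ^ n"
  shows "suminf t \<in> L" "t sums suminf t"
proof -
  have lim: "(\<lambda>n. B * pabs \<zeta> ^ n) \<longlonglongrightarrow> B * 0"
    using pabs_zeta_less_1 by (intro tendsto_intros LIMSEQ_realpow_zero) auto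
  have "(\<lambda>n. pabs (t n)) \<longlonglongrightarrow> 0"
    using assms(2) by (intro tendsto_sandwich[OF _ _ tendsto_const lim[simplified]]) auto
  then obtain l where "l \<in> L" "t sums l"
    using sums_ultrametric[OF complete_L] assms(1) by (auto simp: L_closed)
  thus "suminf t \<in> L" "t sums suminf t"
    using sums_unique by auto
qed

text \<open>The binomial coefficients are integral, so all terms from the quadratic one on are
  bounded by \<open>pabs \<zeta> ^ 2\<close>. Hence [\<gamma>](\<zeta>) determines \<gamma> modulo
  p.\<close>

lemma mfg_mult_approx:
  assumes "\<gamma> \<in> int_ring K"
  shows "pabs (mfg_mult \<gamma> \<zeta> - \<gamma> * \<zeta>) \<le> pabs \<zeta> ^ 2"
proof -
  define t where "t n = fps_nth (fps_binomial \<gamma> - 1) n * \<zeta> ^ n" for n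
  have t: "t n = (if n = 0 then 0 else (\<gamma> gchoose n) * \<zeta> ^ n)" for n
    by (simp add: t_def)
  have "(\<gamma> gchoose n) \<in> K" for n
    using assms by (auto simp: gbinomial_prod_rev int_ring_def fact_prod intro!: K_closed)
  hence "(\<gamma> gchoose n) \<in> L" for n
    using K_subset_L by blast
  hence "t n \<in> L" for n
    by (simp add: t L_closed)
  moreover have le: "pabs (t n) \<le> 1 * pabs \<zeta> ^ n" for n
    unfolding t using pabs_gbinomial_le_1[OF assms, of n]
    by (auto simp: pabs_mult pabs_power intro!: mult_right_mono)
  ultimately have "t sums suminf t" by (rule suminf_L(2))
  hence "pabs (suminf t - sum t {0, 1}) \<le> pabs \<zeta> ^ 2"
  proof (rule sums_pabs_le)
    fix n :: nat assume "n \<notin> {0, 1}"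
    hence "pabs \<zeta> ^ n \<le> pabs \<zeta> ^ 2"
      using pabs_zeta_less_1 by (intro power_decreasing) auto
    thus "pabs (t n) \<le> pabs \<zeta> ^ 2" using le[of n] by simp
  qed auto
  moreover have "mfg_mult \<gamma> \<zeta> = suminf t"
    by (simp only: mfg_mult_def eval_series_def flip: t_def)
  ultimately show ?thesis by (simp add: t)
qed

text \<open>The crude estimate that p divides n at most n - 1 times suffices for the logarithm. It
  is stated in powers of \<open>pabs \<zeta>\<close> to fit the bound on x^n.\<close>

lemma pabs_of_nat_ge:
  assumes "n > 0"
  shows "pabs (of_nat n :: 'a) \<ge> pabs \<zeta> ^ ((p - 1) * (n - 1))"
proof -
  define v where "v = multiplicity (int p) (int n)"
  have "int p ^ v dvd int n" unfolding v_def by (rule multiplicity_dvd)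
  hence "int (p ^ v) \<le> int n" using assms by (auto dest: zdvd_imp_le)
  moreover have "v < p ^ v" using p_gt_1 by (intro power_gt_expt) auto
  ultimately have "v \<le> n - 1" by linarith
  hence "(1 / real p) ^ (n - 1) \<le> (1 / real p) ^ v"
    using p_gt_1 by (intro power_decreasing) auto
  also have "\<dots> = pabs (of_nat n :: 'a)"
    using pabs_int[of "int n"] assms by (simp add: v_def)
  finally show ?thesis by (simp only: power_mult pabs_zeta_power)
qed

text \<open>As p * \<zeta> has the size of \<zeta>^p, the n-th term has exponent at least p * n - (p
  - 1) * (n - 1) = p - 1 + n in \<open>pabs \<zeta>\<close>. From n = 2 on this exceeds p.\<close>

lemma mfg_log_approx:
  assumes "x \<in> L" "pabs x \<le> pabs (of_nat p * \<zeta>)"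
  shows "mfg_log x \<in> L" "pabs (mfg_log x - x) < pabs (of_nat p * \<zeta>)"
proof -
  have p\<zeta>: "pabs (of_nat p * \<zeta>) = pabs \<zeta> ^ p"
    using p_gt_1 by (simp add: pabs_mult pabs_p power_eq_if[of _ p] flip: pabs_zeta_power del: One_nat_def)
  define t where "t n = fps_nth (fps_ln 1) n * x ^ n" for n
  have "t n \<in> L" for n
    using assms(1) by (auto simp: t_def fps_ln_nth intro!: L_closed)
  moreover have le: "pabs (t n) \<le> pabs \<zeta> ^ (p - 1) * pabs \<zeta> ^ n" for n
  proof (cases "n = 0")
    case False
    have "pabs (t n) = pabs x ^ n / pabs (of_nat n :: 'a)"
      using False by (simp add: t_def fps_ln_nth pabs_mult pabs_divide pabs_power)
    also have "\<dots> \<le> (pabs \<zeta> ^ p) ^ n / pabs \<zeta> ^ ((p - 1) * (n - 1))"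
      using assms(2) pabs_of_nat_ge[of n] False
      by (intro frac_le power_mono) (auto simp: p\<zeta>)
    also have "p * n = (p - 1) * (n - 1) + (p - 1 + n)"
    proof -
      obtain q m where "p = Suc q" "n = Suc m" using False p_gt_1 by (cases p; cases n) auto
      thus ?thesis by simp
    qed
    hence "(pabs \<zeta> ^ p) ^ n / pabs \<zeta> ^ ((p - 1) * (n - 1)) = pabs \<zeta> ^ (p - 1) * pabs \<zeta> ^ n"
      by (simp add: power_add flip: power_mult)
    finally show ?thesis .
  qed (simp add: t_def)
  ultimately have "suminf t \<in> L" "t sums suminf t" by (rule suminf_L)+
  thus "mfg_log x \<in> L"
    by (simp add: mfg_log_def eval_series_def t_def[symmetric])
  have "mfg_log x - x = suminf t - sum t {0, 1}"
    by (simp add: mfg_log_def eval_series_def t_def[symmetric]) (simp add: t_def fps_ln_nth)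
  also have "pabs \<dots> \<le> pabs \<zeta> ^ (p + 1)"
    using \<open>t sums suminf t\<close>
  proof (rule sums_pabs_le)
    fix n :: nat assume "n \<notin> {0, 1}"
    hence "pabs \<zeta> ^ (p - 1 + n) \<le> pabs \<zeta> ^ (p + 1)"
      using pabs_zeta_less_1 by (intro power_decreasing) auto
    thus "pabs (t n) \<le> pabs \<zeta> ^ (p + 1)" using le[of n] by (simp add: power_add)
  qed auto
  also have "\<dots> < pabs \<zeta> ^ p"
    using pabs_zeta_less_1 by (intro power_strict_decreasing) auto
  finally show "pabs (mfg_log x - x) < pabs (of_nat p * \<zeta>)"
    by (simp only: p\<zeta>)
qed

section \<open>The trace\<close>

lemma exists_basis: "\<exists>us. is_basis K L us"
  using finite_dimension_L ring.exists_base[OF ring_ambient subfield_K]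
  unfolding ring.finite_dimension_def[OF ring_ambient] is_basis_def by blast

context
  fixes us assumes basis: "is_basis K L us"
begin

lemma basis_subset: "i < length us \<Longrightarrow> us ! i \<in> L"
  using ring.Span_base_incl[OF ring_ambient subfield_K, of us] basis
  by (auto simp: is_basis_def subset_iff)

lemma coords_ex1: "a \<in> L \<Longrightarrow>
    \<exists>!cs. set cs \<subseteq> K \<and> length cs = length us \<and> a = ring.combine ambient cs us"
  using ring.unique_decomposition[OF ring_ambient subfield_K] basis by (simp add: is_basis_def)

lemma coords_props:
  assumes "a \<in> L"
  shows "set (coords K us a) \<subseteq> K" "length (coords K us a) = length us"
    "(\<Sum>i<length us. coords K us a ! i * us ! i) = a"
  using theI'[OF coords_ex1[OF assms]] ambient_combine[of "coords K us a" us]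
  unfolding coords_def by auto

lemma coords_in_K: "a \<in> L \<Longrightarrow> i < length us \<Longrightarrow> coords K us a ! i \<in> K"
  using coords_props[of a] by (auto simp: subset_iff)

lemma coords_lincomb:
  assumes "\<And>j. j \<in> A \<Longrightarrow> k j \<in> K" "\<And>j. j \<in> A \<Longrightarrow> b j \<in> L" "i < length us"
  shows "coords K us (\<Sum>j\<in>A. k j * b j) ! i = (\<Sum>j\<in>A. k j * coords K us (b j) ! i)"
proof -
  define ds where "ds = map (\<lambda>i. \<Sum>j\<in>A. k j * coords K us (b j) ! i) [0..<length us]"
  have "(\<Sum>j\<in>A. k j * b j) = (\<Sum>j\<in>A. k j * (\<Sum>i<length us. coords K us (b j) ! i * us ! i))"
    using assms(2) by (intro sum.cong) (simp_all only: coords_props)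
  also have "\<dots> = (\<Sum>i<length us. (\<Sum>j\<in>A. k j * coords K us (b j) ! i) * us ! i)"
    by (simp add: sum_distrib_left sum_distrib_right mult.assoc) (rule sum.swap)
  also have "\<dots> = ring.combine ambient ds us"
    by (subst ambient_combine) (auto simp: ds_def)
  finally have "(\<Sum>j\<in>A. k j * b j) = ring.combine ambient ds us" .
  moreover have "set ds \<subseteq> K"
    using assms by (auto simp: ds_def intro!: K_closed coords_in_K)
  moreover have "(\<Sum>j\<in>A. k j * b j) \<in> L"
    using assms K_subset_L by (auto intro!: L_closed)
  ultimately have "coords K us (\<Sum>j\<in>A. k j * b j) = ds"
    unfolding coords_def using coords_ex1 by (intro the1_equality) (auto simp: ds_def)
  thus ?thesis using assms(3) by (simp add: ds_def)
qed

text \<open>The basis behind \<open>field_trace\<close> is an arbitrary choice. Expanding each basis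
  in the other and exchanging the sums is the identity tr(AB) = tr(BA).\<close>

lemma trace_basis_change:
  assumes "a \<in> L"
  shows "(\<Sum>i<length us. coords K us (a * us ! i) ! i) = (\<Sum>j<p - 1. zeta_coeff (a * \<zeta> ^ j) j)"
proof -
  have a\<zeta>: "a * \<zeta> ^ j \<in> L" for j using assms by (simp add: L_closed)
  have "(\<Sum>i<length us. coords K us (a * us ! i) ! i) =
      (\<Sum>i<length us. \<Sum>j<p - 1. zeta_coeff (us ! i) j * coords K us (a * \<zeta> ^ j) ! i)"
  proof (rule sum.cong)
    fix i assume i: "i \<in> {..<length us}"
    have "a * us ! i = a * (\<Sum>j<p - 1. zeta_coeff (us ! i) j * \<zeta> ^ j)"
      using basis_subset i by (simp only: zeta_coeff_sum lessThan_iff)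
    also have "\<dots> = (\<Sum>j<p - 1. zeta_coeff (us ! i) j * (a * \<zeta> ^ j))"
      by (simp add: sum_distrib_left mult_ac)
    finally show "coords K us (a * us ! i) ! i =
        (\<Sum>j<p - 1. zeta_coeff (us ! i) j * coords K us (a * \<zeta> ^ j) ! i)"
      using i basis_subset a\<zeta> by (simp only: lessThan_iff coords_lincomb zeta_coeff_in_K)
  qed simp
  also have "\<dots> = (\<Sum>j<p - 1. \<Sum>i<length us. coords K us (a * \<zeta> ^ j) ! i * zeta_coeff (us ! i) j)"
    by (subst sum.swap) (simp add: mult.commute)
  also have "\<dots> = (\<Sum>j<p - 1. zeta_coeff (\<Sum>i<length us. coords K us (a * \<zeta> ^ j) ! i * us ! i) j)"
    using a\<zeta> basis_subset coords_in_K by (intro sum.cong zeta_coeff_lincomb[symmetric]) auto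
  also have "\<dots> = (\<Sum>j<p - 1. zeta_coeff (a * \<zeta> ^ j) j)"
    using a\<zeta> by (simp only: coords_props)
  finally show ?thesis .
qed

end

lemma field_trace_eq:
  assumes "a \<in> L"
  shows "field_trace K L a = (\<Sum>j<p - 1. zeta_coeff (a * \<zeta> ^ j) j)"
  using trace_basis_change[OF someI_ex[OF exists_basis] assms]
  by (simp add: field_trace_def mult_matrix_def)

lemma field_trace_in_K: "a \<in> L \<Longrightarrow> field_trace K L a \<in> K"
  by (auto simp: field_trace_eq intro!: K_closed zeta_coeff_in_K L_closed)

lemma field_trace_scale:
  assumes "k \<in> K" "a \<in> L"
  shows "field_trace K L (k * a) = k * field_trace K L a"
proof -
  have "zeta_coeff (k * a * \<zeta> ^ j) j = k * zeta_coeff (a * \<zeta> ^ j) j" if "j < p - 1" for j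
    using zeta_coeff_lincomb[of "{()}" "\<lambda>_. k" "\<lambda>_. a * \<zeta> ^ j" j] assms that
    by (simp add: L_closed mult.assoc)
  thus ?thesis
    using assms K_subset_L by (auto simp: field_trace_eq L_closed sum_distrib_left subset_iff)
qed

text \<open>The trace of \<open>1\<close> is \<open>p - 1\<close>, and the trace maps the maximal ideal into
  \<open>p\<close> times the integers.\<close>

lemma field_trace_approx:
  assumes "a \<in> L" "pabs (a + of_nat c) < 1"
  shows "pabs (field_trace K L a - of_nat c) < 1"
proof -
  define b where "b = a + of_nat c"
  have b: "b \<in> L" "pabs b < 1" using assms by (auto simp: b_def L_closed)
  have a_coeff: "zeta_coeff (a * \<zeta> ^ j) j = zeta_coeff (b * \<zeta> ^ j) j - of_nat c" if "j < p - 1" for j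
  proof -
    have "zeta_coeff (of_nat c * \<zeta> ^ j) j = (if j = j then of_nat c else 0)"
    proof (rule zeta_coeff_eqI[of "\<lambda>i. if i = j then of_nat c else 0"])
      show "of_nat c * \<zeta> ^ j = (\<Sum>i<p - 1. (if i = j then of_nat c else 0) * \<zeta> ^ i)"
        using that by (subst sum.remove[of _ j]) (auto intro!: sum.neutral)
    qed (use that in \<open>auto simp: K_closed\<close>)
    moreover have "a * \<zeta> ^ j = b * \<zeta> ^ j - of_nat c * \<zeta> ^ j"
      by (simp add: b_def algebra_simps)
    ultimately show ?thesis
      using that b by (simp add: zeta_coeff_diff L_closed)
  qed
  \<comment> \<open>Multiplying by \<zeta>^j costs exactly the factor that
    \<open>pabs_zeta_coeff_le\<close> loses at index j.\<close>
  have b_coeff: "pabs (zeta_coeff (b * \<zeta> ^ j) j) < 1" if "j < p - 1" for j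
  proof -
    have "pabs (zeta_coeff (b * \<zeta> ^ j) j) * pabs \<zeta> ^ j \<le> pabs b * pabs \<zeta> ^ j"
      using pabs_zeta_coeff_le[of "b * \<zeta> ^ j" j] that b by (simp add: L_closed pabs_mult pabs_power)
    thus ?thesis using b by simp
  qed
  have "field_trace K L a = (\<Sum>j<p - 1. zeta_coeff (b * \<zeta> ^ j) j - of_nat c)"
    using assms a_coeff by (simp add: field_trace_eq)
  \<comment> \<open>The p - 1 copies of -c give c - p * c, and p * c disappears modulo p.\<close>
  also have "\<dots> = (\<Sum>j<p - 1. zeta_coeff (b * \<zeta> ^ j) j) - of_nat p * of_nat c + of_nat c"
    using p_gt_1 by (simp add: sum_subtractf of_nat_diff algebra_simps)
  finally have "field_trace K L a - of_nat c =
      (\<Sum>j<p - 1. zeta_coeff (b * \<zeta> ^ j) j) - of_nat (p * c)" by simp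
  moreover have "pabs (\<Sum>j<p - 1. zeta_coeff (b * \<zeta> ^ j) j) < 1"
    using b_coeff by (intro pabs_sum_less) auto
  moreover have "pabs (of_nat (p * c) :: 'a) < 1"
    by (rule le_less_trans[OF pabs_of_nat_dvd_le]) (use p_gt_1 in auto)
  ultimately show ?thesis by (simp only: pabs_diff_less)
qed

section \<open>The pairing\<close>

text \<open>Multiplication by 1 + \<zeta> keeps the old error bounded and adds only c * \<zeta>^2.
  The exponent c is thus visible modulo p in the linear term.\<close>

lemma root_of_unity_power_approx:
  "pabs ((1 + \<zeta>) ^ c - 1 - of_nat c * \<zeta>) \<le> pabs \<zeta> ^ 2"
proof (induction c)
  case (Suc c)
  have "pabs ((1 + \<zeta>) * ((1 + \<zeta>) ^ c - 1 - of_nat c * \<zeta>)) \<le> 1 * pabs \<zeta> ^ 2"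
    unfolding pabs_mult using Suc pabs_zeta_less_1 by (intro mult_mono) (auto intro: pabs_add_le)
  moreover have "pabs (of_nat c * \<zeta> ^ 2) \<le> pabs \<zeta> ^ 2"
    by (simp add: pabs_mult pabs_power mult_left_le_one_le pabs_of_nat_le_1)
  ultimately have "pabs ((1 + \<zeta>) * ((1 + \<zeta>) ^ c - 1 - of_nat c * \<zeta>) + of_nat c * \<zeta> ^ 2) \<le> pabs \<zeta> ^ 2"
    by (intro pabs_add_le) auto
  thus ?case by (simp add: algebra_simps power2_eq_square)
qed simp

section \<open>The Frobenius on an unramified extension\<close>

context
  fixes M \<tau>
  assumes M: "unramified_ext L M" and \<tau>: "is_frobenius L M \<tau>"
begin

lemma subfield_M: "subfield M ambient" and L_subset_M: "L \<subseteq> M"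
  using M by (auto simp: unramified_ext_def finite_ext_def)

lemmas M_closed = subfield_closed[OF subfield_M]

lemma aut_fix: "a \<in> L \<Longrightarrow> \<tau> a = a"
  and aut_add: "a \<in> M \<Longrightarrow> b \<in> M \<Longrightarrow> \<tau> (a + b) = \<tau> a + \<tau> b"
  and aut_mult: "a \<in> M \<Longrightarrow> b \<in> M \<Longrightarrow> \<tau> (a * b) = \<tau> a * \<tau> b"
  using \<tau> by (auto simp: is_frobenius_def field_aut_def)

lemma aut_power: "a \<in> M \<Longrightarrow> \<tau> (a ^ n) = \<tau> a ^ n"
  by (induction n) (auto simp: aut_fix aut_mult M_closed L_closed)

text \<open>Unramifiedness supplies some common prime element of L and M, which need not be \<zeta>;
  but inside L it is an integral multiple of \<zeta>.\<close>

lemma zeta_divides_max_ideal: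
  assumes "y \<in> max_ideal M"
  obtains s where "s \<in> int_ring M" "y = \<zeta> * s"
proof -
  obtain \<pi> where \<pi>: "prime_element L \<pi>" "prime_element M \<pi>"
    using M by (auto simp: unramified_ext_def)
  have "\<pi> * 1 \<in> (*) \<pi> ` int_ring L"
    by (rule imageI) (simp add: int_ring_def L_closed)
  hence "\<pi> \<in> (*) \<zeta> ` int_ring L"
    using \<pi>(1) prime_element_zeta unfolding prime_element_def by simp
  then obtain b where b: "b \<in> int_ring L" "\<pi> = \<zeta> * b" by blast
  obtain s where s: "s \<in> int_ring M" "y = \<pi> * s"
    using assms \<pi>(2) unfolding prime_element_def by auto
  have "b * s \<in> int_ring M"
    using b(1) s(1) L_subset_M by (auto simp: int_ring_def M_closed pabs_mult mult_le_one)
  thus thesis using that b s by (simp add: mult.assoc)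
qed

text \<open>The p-th power of 1 + y lies in L and is fixed, so the quotient of 1 + \<tau> y by 1 + y
  is a p-th root of unity.\<close>

lemma frobenius_eq_root_times:
  assumes "y \<in> max_ideal M" "(1 + y) ^ p - 1 \<in> L"
  shows "\<exists>c. 1 + \<tau> y = (1 + \<zeta>) ^ c * (1 + y)"
proof -
  have y: "y \<in> M" "pabs y < 1" using assms by (auto simp: max_ideal_def)
  hence nz: "1 + y \<noteq> 0" by (intro one_plus_nonzero)
  have "1 + \<tau> y = \<tau> (1 + y)"
    using y by (simp add: aut_add M_closed aut_fix L_closed)
  hence "(1 + \<tau> y) ^ p = \<tau> ((1 + y) ^ p)"
    using y by (simp add: aut_power M_closed)
  also have "\<dots> = (1 + y) ^ p"
    using L_closed(3)[OF assms(2) L_closed(2)] by (intro aut_fix) simp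
  finally have "((1 + \<tau> y) / (1 + y)) ^ p = 1"
    using nz by (simp add: power_divide)
  then obtain c where "(1 + \<tau> y) / (1 + y) = (1 + \<zeta>) ^ c"
    using roots_of_unity by blast
  thus ?thesis using nz by (auto simp: field_simps)
qed

text \<open>Writing \<open>y = \<zeta> * s\<close>, the hypothesis says that the Frobenius adds \<open>c\<close> to the
  residue class of \<open>s\<close>, that is, \<open>s ^ p\<close> is congruent to \<open>s + c\<close>.\<close>

lemma frobenius_approx:
  assumes y: "y \<in> max_ideal M" and c: "1 + \<tau> y = (1 + \<zeta>) ^ c * (1 + y)"
  shows "pabs ((1 + y) ^ p - 1 + of_nat c * of_nat p * \<zeta>) < pabs (of_nat p * \<zeta>)"
proof -
  obtain s where s: "s \<in> int_ring M" "y = \<zeta> * s"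
    using zeta_divides_max_ideal[OF y] .
  have sM: "s \<in> M" "pabs s \<le> 1" using s by (auto simp: int_ring_def)
  define e where "e = (1 + \<zeta>) ^ c - 1 - of_nat c * \<zeta>"
  have "\<tau> y = \<zeta> * \<tau> s"
    unfolding s using sM L_subset_M by (subst aut_mult) (auto simp: aut_fix)
  hence "\<zeta> * \<tau> s = (1 + of_nat c * \<zeta> + e) * (1 + \<zeta> * s) - 1"
    using c s by (simp add: e_def algebra_simps)
  \<comment> \<open>Everything on the right is of second order in \<zeta>, so dividing by \<zeta>
    leaves a congruence for \<tau> s.\<close>
  hence "\<zeta> * (\<tau> s - s - of_nat c) = e * (1 + \<zeta> * s) + of_nat c * s * \<zeta> ^ 2"
    by (simp add: algebra_simps power2_eq_square)
  moreover have "pabs (1 + \<zeta> * s) \<le> 1"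
    using sM pabs_zeta_less_1 by (intro pabs_add_le) (auto simp: pabs_mult mult_le_one)
  hence "pabs (e * (1 + \<zeta> * s)) \<le> pabs \<zeta> ^ 2 * 1"
    unfolding pabs_mult e_def using root_of_unity_power_approx by (intro mult_mono) auto
  moreover have "pabs (of_nat c * s) \<le> 1"
    using sM pabs_of_nat_le_1[of c] by (simp add: pabs_mult mult_le_one)
  hence "pabs (of_nat c * s * \<zeta> ^ 2) \<le> pabs \<zeta> ^ 2"
    unfolding pabs_mult[of _ "\<zeta> ^ 2"] pabs_power by (intro mult_left_le_one_le) auto
  ultimately have "pabs (\<zeta> * (\<tau> s - s - of_nat c)) \<le> pabs \<zeta> ^ 2"
    by (simp add: pabs_add_le)
  hence "pabs (\<tau> s - s - of_nat c) \<le> pabs \<zeta>"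
    by (simp add: pabs_mult power2_eq_square)
  hence "pabs (\<tau> s - s - of_nat c) < 1" using pabs_zeta_less_1 by simp
  moreover have "pabs (\<tau> s - s ^ p) < 1"
    using \<tau> s unfolding is_frobenius_def residue_card_L by (auto simp: max_ideal_def)
  \<comment> \<open>Subtracting the two descriptions of \<tau> s eliminates it and leaves a
    congruence for s alone.\<close>
  ultimately have "pabs ((\<tau> s - s ^ p) - (\<tau> s - s - of_nat c)) < 1"
    by (intro pabs_diff_less[of "\<tau> s - s ^ p"])
  hence "pabs (s - s ^ p + of_nat c) < 1"
    by (simp add: algebra_simps)
  hence "pabs (of_nat p * \<zeta> * (s - s ^ p + of_nat c)) < pabs (of_nat p * \<zeta>)"
    using p_gt_1 by (simp add: pabs_mult[of "of_nat p * \<zeta>"])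
  from pabs_add_less[OF power_p_leading_term[OF sM(2)] this] show ?thesis
    by (simp add: s algebra_simps)
qed

end

section \<open>Evaluation of the pairing\<close>

lemma mfg_diff_eq:
  fixes a b :: 'a
  assumes "pabs b < 1"
  shows "mfg_diff a b = (1 + a) / (1 + b) - 1"
  using one_plus_nonzero[OF assms]
  by (simp add: mfg_diff_def mfg_add_def mfg_neg_def divide_simps) (simp add: algebra_simps)

text \<open>This settles the definite description: another root w of [p](w) = x has 1 + w differing
  from 1 + y by a p-th root of unity, which lies in L and is fixed by \<sigma> t, so the quotients
  agree.\<close>

lemma hilbert_pairing_eq:
  assumes \<sigma>: "\<And>M. unramified_ext L M \<Longrightarrow> is_frobenius L M (\<sigma> t)"
    and M: "unramified_ext L M" and y: "y \<in> max_ideal M"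
  shows "hilbert_pairing p L \<sigma> t ((1 + y) ^ p - 1) = mfg_diff (\<sigma> t y) y"
  unfolding hilbert_pairing_def
proof (rule the_equality)
  show "\<exists>M ya. unramified_ext L M \<and> ya \<in> max_ideal M \<and>
      mfg_mult (of_nat p) ya = (1 + y) ^ p - 1 \<and> mfg_diff (\<sigma> t y) y = mfg_diff (\<sigma> t ya) ya"
    using M y mfg_mult_of_nat by blast
next
  fix z assume "\<exists>M ya. unramified_ext L M \<and> ya \<in> max_ideal M \<and>
      mfg_mult (of_nat p) ya = (1 + y) ^ p - 1 \<and> z = mfg_diff (\<sigma> t ya) ya"
  then obtain N w where N: "unramified_ext L N" and w: "w \<in> max_ideal N"
    and eq: "(1 + w) ^ p = (1 + y) ^ p" and z: "z = mfg_diff (\<sigma> t w) w"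
    by (auto simp: mfg_mult_of_nat)
  have less: "pabs w < 1" "pabs y < 1" using y w by (auto simp: max_ideal_def)
  hence nz: "1 + w \<noteq> 0" "1 + y \<noteq> 0" by (auto dest: one_plus_nonzero)
  hence "((1 + y) / (1 + w)) ^ p = 1" by (simp add: power_divide eq)
  then obtain c where "(1 + y) / (1 + w) = (1 + \<zeta>) ^ c" using roots_of_unity by blast
  hence yw: "(1 + \<zeta>) ^ c * (1 + w) = 1 + y" using nz by (simp add: field_simps)
  note frob = N \<sigma>[OF N]
  have in_L: "1 \<in> L" "(1 + \<zeta>) ^ c \<in> L" by (simp_all add: L_closed)
  hence in_N: "1 \<in> N" "(1 + \<zeta>) ^ c \<in> N" "w \<in> N"
    using L_subset_M[OF frob] w by (auto simp: max_ideal_def)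
  have "y = (1 + \<zeta>) ^ c * (1 + w) - 1" unfolding yw by simp
  \<comment> \<open>Both roots lie in N, so they can be compared there without forming a compositum
    of M and N.\<close>
  hence "y \<in> N" using in_N by (simp only: M_closed[OF frob])
  have "1 + \<sigma> t y = \<sigma> t (1 + y)"
    using in_N in_L \<open>y \<in> N\<close> by (simp only: aut_add[OF frob] aut_fix[OF frob])
  also have "\<dots> = (1 + \<zeta>) ^ c * (1 + \<sigma> t w)"
    using in_N in_L
    by (simp only: aut_mult[OF frob] aut_add[OF frob] aut_fix[OF frob] M_closed[OF frob]
        flip: yw)
  finally have "(1 + \<sigma> t y) / (1 + y) = (1 + \<sigma> t w) / (1 + w)"
    using nz unfolding yw[symmetric] by (auto simp: divide_simps)
  thus "z = mfg_diff (\<sigma> t y) y"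
    using less by (simp add: z mfg_diff_eq)
qed

text \<open>Both \<gamma> and the trace are compared with the same natural number c, the exponent of
  the root of unity by which the Frobenius multiplies 1 + y.\<close>

lemma hilbert_pairing_formula:
  assumes \<sigma>: "local_reciprocity_map L \<sigma>"
    and x: "x \<in> max_ideal L" and M: "unramified_ext L M" and y: "y \<in> max_ideal M"
    and xy: "(1 + y) ^ p - 1 = x" and \<gamma>: "\<gamma> \<in> int_ring K"
    and pairing: "hilbert_pairing p L \<sigma> \<zeta> x = mfg_mult \<gamma> \<zeta>"
  shows "\<exists>z\<in>int_ring K.
    \<gamma> - 1 / of_nat p * field_trace K L (inverse \<zeta> * (1 + \<zeta>) * mfg_log x) = of_nat p * z"
proof -
  have frob: "is_frobenius L N (\<sigma> \<zeta>)" if "unramified_ext L N" for N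
    using \<sigma> prime_element_zeta that unfolding local_reciprocity_map_def by blast
  have xL: "x \<in> L" using x by (simp add: max_ideal_def)
  obtain c where c: "1 + \<sigma> \<zeta> y = (1 + \<zeta>) ^ c * (1 + y)"
    using frobenius_eq_root_times[OF M frob[OF M] y] xL xy by blast
  have y1: "pabs y < 1" using y by (simp add: max_ideal_def)
  hence nz: "1 + y \<noteq> 0" by (rule one_plus_nonzero)
  have mult: "mfg_mult \<gamma> \<zeta> = (1 + \<zeta>) ^ c - 1"
    using hilbert_pairing_eq[where \<sigma> = \<sigma> and t = \<zeta>, OF frob M y] nz
    by (simp add: xy pairing mfg_diff_eq[OF y1] c)
  \<comment> \<open>The two second-order approximations describe the same element, so their linear
    coefficients c and \<gamma> agree modulo \<zeta>.\<close>
  have "pabs (((1 + \<zeta>) ^ c - 1 - of_nat c * \<zeta>) - (mfg_mult \<gamma> \<zeta> - \<gamma> * \<zeta>)) \<le> pabs \<zeta> ^ 2"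
    by (rule pabs_diff_le[OF root_of_unity_power_approx mfg_mult_approx[OF \<gamma>]])
  also have "((1 + \<zeta>) ^ c - 1 - of_nat c * \<zeta>) - (mfg_mult \<gamma> \<zeta> - \<gamma> * \<zeta>) = (\<gamma> - of_nat c) * \<zeta>"
    by (simp add: mult algebra_simps)
  finally have "pabs (\<gamma> - of_nat c) \<le> pabs \<zeta>"
    by (simp add: pabs_mult power2_eq_square)
  hence \<gamma>c: "pabs (\<gamma> - of_nat c) < 1" using pabs_zeta_less_1 by simp
  have x_approx: "pabs (x + of_nat c * of_nat p * \<zeta>) < pabs (of_nat p * \<zeta>)"
    using frobenius_approx[OF M frob[OF M] y c] by (simp add: xy)
  have "pabs (of_nat c * (of_nat p * \<zeta>)) \<le> pabs (of_nat p * \<zeta>)"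
    unfolding pabs_mult[of "of_nat c"] by (intro mult_left_le_one_le) (auto simp: pabs_of_nat_le_1)
  hence "pabs x \<le> pabs (of_nat p * \<zeta>)"
    using pabs_diff_le[OF less_imp_le[OF x_approx]] by (fastforce simp: mult.assoc)
  note log = mfg_log_approx[OF xL this]
  \<comment> \<open>The factor 1/p is moved inside the trace, which is K-linear, so that the
    argument becomes integral.\<close>
  define w where "w = inverse \<zeta> * (1 + \<zeta>) * mfg_log x / of_nat p"
  have w: "w \<in> L" unfolding w_def using log(1) by (intro L_closed zeta_in_L)
  have "pabs ((mfg_log x - x) + (x + of_nat c * of_nat p * \<zeta>)) < pabs (of_nat p * \<zeta>)"
    using log(2) x_approx by (rule pabs_add_less)
  hence "pabs ((mfg_log x + of_nat c * of_nat p * \<zeta>) / (of_nat p * \<zeta>)) < 1"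
    using p_gt_1 by (simp add: pabs_divide)
  moreover have "pabs (1 + \<zeta>) \<le> 1"
    using pabs_zeta_less_1 by (intro pabs_add_le) auto
  ultimately have "pabs ((1 + \<zeta>) * ((mfg_log x + of_nat c * of_nat p * \<zeta>) / (of_nat p * \<zeta>))) < 1"
    unfolding pabs_mult[of "1 + \<zeta>"]
    by (intro le_less_trans[OF mult_left_le_one_le]) auto
  moreover have "pabs (of_nat c * \<zeta>) < 1"
    using pabs_zeta_less_1 pabs_of_nat_le_1[of c] unfolding pabs_mult
    by (intro le_less_trans[OF mult_left_le_one_le]) auto
  ultimately have "pabs ((1 + \<zeta>) * ((mfg_log x + of_nat c * of_nat p * \<zeta>) / (of_nat p * \<zeta>))
      - of_nat c * \<zeta>) < 1"
    by (rule pabs_diff_less)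
  \<comment> \<open>The factor 1 + \<zeta> is 1 modulo \<zeta>; its effect on the constant c is the
    subtracted c * \<zeta>.\<close>
  also have "(1 + \<zeta>) * ((mfg_log x + of_nat c * of_nat p * \<zeta>) / (of_nat p * \<zeta>)) - of_nat c * \<zeta>
      = w + of_nat c"
    using p_gt_1 by (simp add: w_def field_simps)
  finally have "pabs (field_trace K L w - of_nat c) < 1"
    by (rule field_trace_approx[OF w])
  hence "pabs ((\<gamma> - of_nat c) - (field_trace K L w - of_nat c)) < 1"
    by (rule pabs_diff_less[OF \<gamma>c])
  hence "pabs (\<gamma> - field_trace K L w) < 1" by simp
  \<comment> \<open>Membership in K turns the strict inequality into divisibility by p.\<close>
  moreover have "\<gamma> - field_trace K L w \<in> K"
    using \<gamma> field_trace_in_K[OF w] by (simp add: int_ring_def K_closed)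
  ultimately obtain z where "z \<in> int_ring K" "\<gamma> - field_trace K L w = of_nat p * z"
    using int_ring_K_dvd by blast
  moreover have "field_trace K L (inverse \<zeta> * (1 + \<zeta>) * mfg_log x) = of_nat p * field_trace K L w"
    using field_trace_scale[OF _ w, of "of_nat p"] p_gt_1 by (simp add: w_def K_closed)
  ultimately show ?thesis using p_gt_1 by auto
qed

end

theorem theorem2:
  fixes p k :: nat
    and K L M :: "'a::{field_char_0, metric_space} set"
    and \<sigma> :: "'a \<Rightarrow> 'a \<Rightarrow> 'a"
    and \<eta> \<zeta> \<pi> x y \<gamma> :: 'a
  assumes "padic_closure p K"
    and "primitive_root_of_unity p \<eta>"
    and "\<zeta> = \<eta> - 1" and "\<pi> = \<zeta>"
    and "L = generate_field ambient (insert \<zeta> K)"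
    and "local_reciprocity_map L \<sigma>"
    and "x \<in> max_ideal L"
    and "unramified_ext L M"
    and "ring.dimension ambient (p ^ k) L M"
    and "\<not> (\<exists>\<xi>\<in>M. primitive_root_of_unity (p ^ 2) \<xi>)"
    and "y \<in> max_ideal M"
    and "mfg_mult (of_nat p) y = x"
    and "\<gamma> \<in> int_ring K"
    and "hilbert_pairing p L \<sigma> \<pi> x = mfg_mult \<gamma> \<zeta>"
  shows "\<exists>z \<in> int_ring K.
    \<gamma> - 1 / of_nat p * field_trace K L (inverse \<pi> * \<eta> * mfg_log x) = of_nat p * z"
proof -
  have "1 + \<zeta> = \<eta>" using assms(3) by simp
  then interpret cyclotomic p K \<zeta> L
    using assms(1,2,5) by unfold_locales simp_all
  show ?thesis
    using hilbert_pairing_formula[OF assms(6,7,8,11) _ assms(13)] assms(4,12,14) \<open>1 + \<zeta> = \<eta>\<close>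
    by (simp add: mfg_mult_of_nat)
qed

end
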